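(* Consider the \textsc{Threshold}-$v$ problem in the noisy value model. Let $\varepsilon>0$ be a constant. Fix an arbitrary set $X$ of $n$ elements with values $v_1,\dots,v_n$ such that the number $\ell$ of distinct values satisfies $\ell=O(n^{1-\varepsilon})$, and let $k_v$ be the number of elements with value at least $v$. Then any algorithm that solves the problem with correctness probability at least $2/3$ on every input, even with prior knowledge of the multiset of values $\{v_1,\dots,v_n\}$ (but not of which element holds which value) and with no constraint on the number of rounds, has query complexity $\Omega\left(n+n\log(\min\{k_v,n-k_v\})\right)$ on (some permutation of) this instance.
   Context: \textsc{Threshold}-$v$ problem: given elements carrying values and a threshold $v$, output exactly the elements whose value is at least $v$. Noisy value model: a query about element $i$ returns its true value with probability $2/3$ and an arbitrary (adversarial) value otherwise. The instance-optimal query complexity of an instance $J$ is $\inf_{A}\sup_{I}$ (query complexity of $A$ on $I$), where $A$ ranges over algorithms correct with probability at least $2/3$ on every input and $I$ ranges over permutations of $J$. *)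

theory Defs
  imports "HOL-Probability.Probability" "HOL-Library.Multiset"
begin

text \<open>
  An instance with \<open>n\<close> elements is a list \<open>xs\<close> of length \<open>n\<close>: element \<open>i < n\<close> carries the
  value \<open>xs ! i\<close>. The permutations of \<open>xs\<close> are the lists \<open>ys\<close> with \<open>mset ys = mset xs\<close>.
\<close>

definition threshold_set :: "real \<Rightarrow> real list \<Rightarrow> nat set" where
  "threshold_set v xs = {i. i < length xs \<and> v \<le> xs ! i}"

definition num_ge :: "real \<Rightarrow> real list \<Rightarrow> nat" where
  "num_ge v xs = card (threshold_set v xs)"

type_synonym history = "(nat \<times> real) list"

datatype action = Query nat | Output "nat set"

text \<open>
  A fully adaptive randomized algorithm chooses its next action at random depending on all
  queries and answers seen so far (oldest first). There are only countably many sensible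
  actions, so discrete distributions lose no generality. The adversary chooses the value
  returned when a query is answered wrongly; it is a function of the history, may randomize,
  and may depend on the instance and on the algorithm because it is always quantified after them.
\<close>

type_synonym algorithm = "history \<Rightarrow> action pmf"

type_synonym adversary = "history \<Rightarrow> nat \<Rightarrow> real pmf"

definition algorithm_on :: "nat \<Rightarrow> algorithm \<Rightarrow> bool" where
  "algorithm_on n A \<longleftrightarrow> (\<forall>h i. Query i \<in> set_pmf (A h) \<longrightarrow> i < n)"

definition noisy_answer :: "real list \<Rightarrow> adversary \<Rightarrow> history \<Rightarrow> nat \<Rightarrow> real pmf" where
  "noisy_answer xs adv h i =
     bind_pmf (bernoulli_pmf (2/3)) (\<lambda>b. if b then return_pmf (xs ! i) else adv h i)"

text \<open>
  State after \<open>t\<close> steps: the history and, once the algorithm has stopped, its output.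
  Every step of an algorithm that has not stopped is either one query or the output.
\<close>

primrec run :: "algorithm \<Rightarrow> adversary \<Rightarrow> real list \<Rightarrow> nat \<Rightarrow> (history \<times> nat set option) pmf" where
  "run A adv xs 0 = return_pmf ([], None)"
| "run A adv xs (Suc t) =
     bind_pmf (run A adv xs t) (\<lambda>(h, out).
       case out of
         Some S \<Rightarrow> return_pmf (h, Some S)
       | None \<Rightarrow> bind_pmf (A h) (\<lambda>a.
           case a of
             Output S \<Rightarrow> return_pmf (h, Some S)
           | Query i \<Rightarrow> map_pmf (\<lambda>y. (h @ [(i, y)], None)) (noisy_answer xs adv h i)))"

text \<open>
  Both suprema over \<open>t\<close> are limits of nondecreasing sequences. Runs that never stop count as
  failures and contribute infinitely many queries.
\<close>

definition success_prob :: "algorithm \<Rightarrow> adversary \<Rightarrow> real \<Rightarrow> real list \<Rightarrow> real" where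
  "success_prob A adv v xs =
     (SUP t. measure_pmf.prob (run A adv xs t) {(h, out). out = Some (threshold_set v xs)})"

definition solves_threshold :: "algorithm \<Rightarrow> real \<Rightarrow> real list \<Rightarrow> bool" where
  "solves_threshold A v xs \<longleftrightarrow> (\<forall>adv. 2/3 \<le> success_prob A adv v xs)"

definition expected_queries :: "algorithm \<Rightarrow> adversary \<Rightarrow> real list \<Rightarrow> ennreal" where
  "expected_queries A adv xs =
     (SUP t. \<integral>\<^sup>+ s. of_nat (length (fst s)) \<partial>measure_pmf (run A adv xs t))"

definition query_complexity :: "algorithm \<Rightarrow> real list \<Rightarrow> ennreal" where
  "query_complexity A xs = (SUP adv. expected_queries A adv xs)"

text \<open>
  Correctness on every input of the given size, respectively on every input that is consistent
  with prior knowledge of the multiset of values.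
\<close>

definition correct_on_all_inputs :: "algorithm \<Rightarrow> real \<Rightarrow> nat \<Rightarrow> bool" where
  "correct_on_all_inputs A v n \<longleftrightarrow> (\<forall>ys. length ys = n \<longrightarrow> solves_threshold A v ys)"

definition correct_given_multiset :: "algorithm \<Rightarrow> real \<Rightarrow> real multiset \<Rightarrow> bool" where
  "correct_given_multiset A v M \<longleftrightarrow> (\<forall>ys. mset ys = M \<longrightarrow> solves_threshold A v ys)"

end

theory Submission
  imports Defs "HOL-Combinatorics.Multiset_Permutations" "HOL-Real_Asymp.Real_Asymp"
begin

text \<open>
  Hide the values behind persistent fakes: a location either answers honestly or, when lying,
  always returns one fake value drawn from the empirical distribution of the values. Call a liar
  whose first \<open>q\<close> answers are all lies a \<^emph>\<open>deceiver\<close>, and a location \<^emph>\<open>late\<close> once it has been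
  queried more than \<open>q\<close> times. Until it is late, a deceiver answers independently of its true
  value, so over a random permutation the true values on the deceivers that are not late are
  exchangeable. If both a high and a low value occur there, swapping them shows that the output
  is wrong with conditional probability at least \<open>1/2\<close>.

  A location is a deceiver with probability about \<open>3\<^sup>-\<^sup>q\<close>, so \<open>q\<close> may be a small multiple of
  \<open>log (min k (n - k))\<close>. An algorithm with too few queries makes only a small fraction of all
  locations late, and it must not find most deceivers among them. If the values at the locations
  were independent, a location about to become late would be a deceiver with probability
  \<open>O(3\<^sup>-\<^sup>q)\<close> whatever has been seen, which gives a failure probability
  \<open>exp (- \<Omega>(n 3\<^sup>-\<^sup>q))\<close>. Conditioning on the multiset of values costs a factor \<open>(e n)\<^sup>\<ell>\<close>
  where \<open>\<ell>\<close> is the number of distinct values. This is affordable because \<open>\<ell> = O(n\<^sup>1\<^sup>-\<^sup>\<epsilon>)\<close>.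
\<close>

section \<open>Path sums: runs with the answer probabilities stripped off\<close>

definition query_step ::
    "algorithm \<Rightarrow> real set \<Rightarrow> (history \<times> nat set option \<Rightarrow> ennreal) \<Rightarrow> history \<times> nat set option \<Rightarrow> ennreal"
  where "query_step A V \<psi> s =
    (case snd s of
       Some S \<Rightarrow> \<psi> s
     | None \<Rightarrow> \<integral>\<^sup>+ a. (case a of
           Output S \<Rightarrow> \<psi> (fst s, Some S)
         | Query i \<Rightarrow> \<Sum>y\<in>V. \<psi> (fst s @ [(i, y)], None)) \<partial>measure_pmf (A (fst s)))"

text \<open>
  \<open>path_sum A V t \<psi>\<close> sums \<open>\<psi>\<close> over all states after \<open>t\<close> steps with answers in \<open>V\<close>, weighted only
  by the probabilities of the algorithm's own choices. All answer models become densities for it.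
\<close>

primrec path_sum ::
    "algorithm \<Rightarrow> real set \<Rightarrow> nat \<Rightarrow> (history \<times> nat set option \<Rightarrow> ennreal) \<Rightarrow> ennreal" where
  "path_sum A V 0 = (\<lambda>\<psi>. \<psi> ([], None))"
| "path_sum A V (Suc t) = (\<lambda>\<psi>. path_sum A V t (query_step A V \<psi>))"

lemma query_step_mono:
  assumes "\<And>s. \<psi> s \<le> \<psi>' s"
  shows "query_step A V \<psi> s \<le> query_step A V \<psi>' s"
  unfolding query_step_def
  by (auto split: option.split action.split intro!: assms nn_integral_mono sum_mono)

lemma path_sum_mono:
  assumes "\<And>s. \<psi> s \<le> \<psi>' s"
  shows "path_sum A V t \<psi> \<le> path_sum A V t \<psi>'"
  using assms by (induction t arbitrary: \<psi> \<psi>') (simp_all add: query_step_mono)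

lemma query_step_add:
  "query_step A V (\<lambda>s. \<psi> s + \<psi>' s) = (\<lambda>s. query_step A V \<psi> s + query_step A V \<psi>' s)"
proof
  fix s
  show "query_step A V (\<lambda>s. \<psi> s + \<psi>' s) s = query_step A V \<psi> s + query_step A V \<psi>' s"
    unfolding query_step_def
    by (auto split: option.split simp: nn_integral_add[symmetric] sum.distrib
        intro!: nn_integral_cong split: action.split)
qed

lemma path_sum_add:
  "path_sum A V t (\<lambda>s. \<psi> s + \<psi>' s) = path_sum A V t \<psi> + path_sum A V t \<psi>'"
  by (induction t arbitrary: \<psi> \<psi>') (simp_all add: query_step_add)

lemma query_step_cmult:
  "query_step A V (\<lambda>s. c * \<psi> s) = (\<lambda>s. c * query_step A V \<psi> s)"
proof
  fix s
  show "query_step A V (\<lambda>s. c * \<psi> s) s = c * query_step A V \<psi> s"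
    unfolding query_step_def
    by (auto split: option.split simp: nn_integral_cmult[symmetric] sum_distrib_left
        intro!: nn_integral_cong split: action.split)
qed

lemma path_sum_cmult:
  "path_sum A V t (\<lambda>s. c * \<psi> s) = c * path_sum A V t \<psi>"
  by (induction t arbitrary: \<psi>) (simp_all add: query_step_cmult)

lemma path_sum_sum:
  assumes "finite I"
  shows "path_sum A V t (\<lambda>s. \<Sum>j\<in>I. \<psi> j s) = (\<Sum>j\<in>I. path_sum A V t (\<psi> j))"
  using assms
proof (induction I)
  case empty
  show ?case using path_sum_cmult[of A V t 0 "\<lambda>_. 0"] by simp
qed (simp add: path_sum_add)

text \<open>An output leaves the history alone, and a query, whichever one is chosen, does not
  increase the sum of \<open>W\<close> over the answers; averaging over the choices of
  \<open>A\<close> keeps this. Reasoning about adaptive strategies is thus replaced by a one-query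
  inequality.\<close>

lemma path_sum_supermartingale:
  assumes A: "algorithm_on n A"
    and W: "\<And>h i. i < n \<Longrightarrow> (\<Sum>y\<in>V. W (h @ [(i, y)])) \<le> W h"
  shows "path_sum A V t (\<lambda>s. W (fst s)) \<le> W []"
proof (induction t)
  case (Suc t)
  have "query_step A V (\<lambda>s. W (fst s)) s \<le> W (fst s)" for s
  proof (cases "snd s")
    case None
    have "query_step A V (\<lambda>s. W (fst s)) s =
        (\<integral>\<^sup>+ a. (case a of Output S \<Rightarrow> W (fst s)
           | Query i \<Rightarrow> \<Sum>y\<in>V. W (fst s @ [(i, y)])) \<partial>measure_pmf (A (fst s)))"
      using None by (simp add: query_step_def)
    also have "\<dots> \<le> (\<integral>\<^sup>+ a. W (fst s) \<partial>measure_pmf (A (fst s)))"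
      using A W by (intro nn_integral_mono_AE)
        (auto simp: AE_measure_pmf_iff algorithm_on_def split: action.split)
    finally show ?thesis by simp
  qed (simp add: query_step_def)
  then have "path_sum A V t (query_step A V (\<lambda>s. W (fst s))) \<le> path_sum A V t (\<lambda>s. W (fst s))"
    by (rule path_sum_mono)
  then show ?case using Suc by simp
qed simp

section \<open>Answers grouped by location, and products over locations\<close>

definition resp :: "nat \<Rightarrow> history \<Rightarrow> real list" where
  "resp i h = map snd (filter (\<lambda>p. fst p = i) h)"

lemma resp_Nil [simp]: "resp i [] = []"
  by (simp add: resp_def)

lemma resp_snoc: "resp j (h @ [(i, y)]) = (if j = i then resp i h @ [y] else resp j h)"
  by (simp add: resp_def)

lemma sum_length_resp_le: "finite I \<Longrightarrow> (\<Sum>i\<in>I. length (resp i h)) \<le> length h"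
proof (induction h rule: rev_induct)
  case (snoc p h)
  obtain i y where p: "p = (i, y)" by force
  have "(\<Sum>j\<in>I. length (resp j (h @ [(i, y)]))) = (\<Sum>j\<in>I. length (resp j h) + (if j = i then 1 else 0))"
    by (intro sum.cong) (auto simp: resp_snoc)
  also have "\<dots> \<le> (\<Sum>j\<in>I. length (resp j h)) + 1"
    using snoc.prems by (simp add: sum.distrib)
  finally show ?case using snoc p by simp
qed simp

lemma prod_resp_snoc:
  fixes \<phi> :: "nat \<Rightarrow> real list \<Rightarrow> 'a :: comm_monoid_mult"
  assumes "i < n"
  shows "(\<Prod>j<n. \<phi> j (resp j (h @ [(i, y)]))) =
    \<phi> i (resp i h @ [y]) * (\<Prod>j\<in>{..<n} - {i}. \<phi> j (resp j h))"
  using assms by (subst prod.remove[of _ i]) (auto simp: resp_snoc intro!: arg_cong2[where f = "(*)"] prod.cong)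

text \<open>A query changes only the factor of its own location, so consistency under one more
  answer can be checked factor by factor.\<close>

lemma sum_prod_resp_snoc:
  fixes \<phi> :: "nat \<Rightarrow> real list \<Rightarrow> real"
  assumes "i < n" and "(\<Sum>y\<in>V. \<phi> i (resp i h @ [y])) = \<phi> i (resp i h)"
  shows "(\<Sum>y\<in>V. \<Prod>j<n. \<phi> j (resp j (h @ [(i, y)]))) = (\<Prod>j<n. \<phi> j (resp j h))"
  using assms by (simp add: prod_resp_snoc sum_distrib_right[symmetric] prod.remove[of "{..<n}" i])

lemma sum_prod_resp_snoc_le:
  fixes \<phi> :: "nat \<Rightarrow> real list \<Rightarrow> real"
  assumes "i < n" and "(\<Sum>y\<in>V. \<phi> i (resp i h @ [y])) \<le> \<phi> i (resp i h)"
    and "\<And>j. j < n \<Longrightarrow> 0 \<le> \<phi> j (resp j h)"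
  shows "(\<Sum>y\<in>V. \<Prod>j<n. \<phi> j (resp j (h @ [(i, y)]))) \<le> (\<Prod>j<n. \<phi> j (resp j h))"
  using assms
  by (simp add: prod_resp_snoc sum_distrib_right[symmetric] prod.remove[of "{..<n}" i])
     (intro mult_right_mono prod_nonneg; simp)

section \<open>Runs against one fixed fake value per location\<close>

text \<open>An honest location is the case \<open>f = x\<close>: both indicators then agree and the
  weights add up to 1.\<close>

definition ans :: "real \<Rightarrow> real \<Rightarrow> real \<Rightarrow> real" where
  "ans x f y = 2/3 * of_bool (y = x) + 1/3 * of_bool (y = f)"

definition lik :: "real \<Rightarrow> real \<Rightarrow> real list \<Rightarrow> real" where
  "lik x f r = prod_list (map (ans x f) r)"

lemma ans_nonneg: "0 \<le> ans x f y"
  by (simp add: ans_def)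

lemma lik_Nil [simp]: "lik x f [] = 1"
  by (simp add: lik_def)

lemma lik_snoc: "lik x f (r @ [y]) = lik x f r * ans x f y"
  by (simp add: lik_def)

lemma lik_append: "lik x f (r @ r') = lik x f r * lik x f r'"
  by (simp add: lik_def)

lemma lik_nonneg: "0 \<le> lik x f r"
  by (induction r rule: rev_induct) (auto simp: lik_snoc ans_nonneg)

lemma lik_honest: "lik x x r = of_bool (\<forall>y\<in>set r. y = x)"
  by (induction r rule: rev_induct) (auto simp: lik_snoc ans_def)

lemma sum_ans: "finite V \<Longrightarrow> x \<in> V \<Longrightarrow> f \<in> V \<Longrightarrow> (\<Sum>y\<in>V. ans x f y) = 1"
proof -
  assume "finite V" "x \<in> V" "f \<in> V"
  moreover have "(\<Sum>y\<in>V. ans x f y) = (\<Sum>y\<in>V. if y = x then 2/3 else 0) + (\<Sum>y\<in>V. if y = f then 1/3 else 0)"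
    unfolding sum.distrib[symmetric] by (intro sum.cong) (auto simp: ans_def)
  ultimately show ?thesis by simp
qed

lemma pmf_noisy_answer_const:
  "pmf (noisy_answer ys (\<lambda>h i. return_pmf (f i)) h i) y = ans (ys ! i) (f i) y"
  unfolding noisy_answer_def
  by (simp add: pmf_bind ans_def indicator_def of_bool_def eq_commute)

text \<open>Change of measure: with one fixed fake per location, an answer depends on nothing but
  the location queried, so the product of the weights \<open>ans\<close> is the density of the run
  relative to \<open>path_sum\<close>.\<close>

lemma nn_integral_run:
  assumes A: "algorithm_on n A" and V: "finite V"
    and ys: "\<And>i. i < n \<Longrightarrow> ys ! i \<in> V" and f: "\<And>i. i < n \<Longrightarrow> f i \<in> V"
  shows "(\<integral>\<^sup>+ s. \<phi> s \<partial>measure_pmf (run A (\<lambda>h i. return_pmf (f i)) ys t)) =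
    path_sum A V t (\<lambda>s. ennreal (\<Prod>i<n. lik (ys ! i) (f i) (resp i (fst s))) * \<phi> s)"
proof (induction t arbitrary: \<phi>)
  case (Suc t)
  let ?adv = "\<lambda>h i. return_pmf (f i)"
  let ?L = "\<lambda>h. \<Prod>i<n. lik (ys ! i) (f i) (resp i h)"
  \<comment> \<open>\<open>\<phi>'\<close> is the conditional expectation of \<open>\<phi>\<close>
    after one more step of the run.\<close>
  define \<phi>' where "\<phi>' = (\<lambda>s :: history \<times> nat set option. case snd s of Some S \<Rightarrow> \<phi> s
     | None \<Rightarrow> \<integral>\<^sup>+ a. (case a of Output S \<Rightarrow> \<phi> (fst s, Some S)
         | Query i \<Rightarrow> \<integral>\<^sup>+ y. \<phi> (fst s @ [(i, y)], None) \<partial>noisy_answer ys ?adv (fst s) i) \<partial>A (fst s))"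
  have L0: "0 \<le> ?L h" for h by (simp add: prod_nonneg lik_nonneg)
  have step: "query_step A V (\<lambda>s. ennreal (?L (fst s)) * \<phi> s) s = ennreal (?L (fst s)) * \<phi>' s" for s
  proof (cases "snd s")
    case None
    obtain h where s: "s = (h, None)" using None by (cases s) auto
    have q: "(\<Sum>y\<in>V. ennreal (?L (h @ [(i, y)])) * \<phi> (h @ [(i, y)], None)) =
        ennreal (?L h) * (\<integral>\<^sup>+ y. \<phi> (h @ [(i, y)], None) \<partial>noisy_answer ys ?adv h i)" if i: "i < n" for i
    proof -
      have "(\<integral>\<^sup>+ y. \<phi> (h @ [(i, y)], None) \<partial>noisy_answer ys ?adv h i) =
          (\<Sum>y\<in>V. \<phi> (h @ [(i, y)], None) * pmf (noisy_answer ys ?adv h i) y)"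
        using V ys[OF i] f[OF i]
        by (intro nn_integral_measure_pmf_support)
          (auto simp: noisy_answer_def split: if_splits)
      moreover have "?L (h @ [(i, y)]) = ?L h * ans (ys ! i) (f i) y" for y
        using i by (subst prod_resp_snoc[OF i]) (simp add: lik_snoc prod.remove[of "{..<n}" i])
      ultimately show ?thesis
        by (simp add: pmf_noisy_answer_const sum_distrib_left ennreal_mult' L0 ans_nonneg mult_ac)
    qed
    have "query_step A V (\<lambda>s. ennreal (?L (fst s)) * \<phi> s) s =
       (\<integral>\<^sup>+ a. (case a of Output S \<Rightarrow> ennreal (?L h) * \<phi> (h, Some S)
         | Query i \<Rightarrow> \<Sum>y\<in>V. ennreal (?L (h @ [(i, y)])) * \<phi> (h @ [(i, y)], None)) \<partial>A h)"
      by (simp add: query_step_def s)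
    also have "\<dots> = (\<integral>\<^sup>+ a. ennreal (?L h) * (case a of Output S \<Rightarrow> \<phi> (h, Some S)
         | Query i \<Rightarrow> \<integral>\<^sup>+ y. \<phi> (h @ [(i, y)], None) \<partial>noisy_answer ys ?adv h i) \<partial>A h)"
      using A q by (intro nn_integral_cong_AE)
        (auto simp: AE_measure_pmf_iff algorithm_on_def split: action.split)
    finally show ?thesis by (simp add: \<phi>'_def s nn_integral_cmult)
  qed (simp add: query_step_def \<phi>'_def)
  have "(\<integral>\<^sup>+ s. \<phi> s \<partial>measure_pmf (run A ?adv ys (Suc t))) =
     (\<integral>\<^sup>+ s. \<phi>' s \<partial>measure_pmf (run A ?adv ys t))"
    by (auto simp: \<phi>'_def split_beta' intro!: nn_integral_cong split: option.split action.split)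
  then show ?case using Suc by (simp add: step[abs_def])
qed simp

section \<open>Persistent fakes, liars and deceivers\<close>

text \<open>Choose one summand in each factor; \<open>G\<close> records where \<open>a\<close> was
  taken. Later \<open>G\<close> becomes the set of deceivers.\<close>

lemma prod_add_Pow_if:
  fixes a b :: "'a \<Rightarrow> 'b :: comm_semiring_1"
  assumes "finite I"
  shows "(\<Prod>i\<in>I. a i + b i) = (\<Sum>G\<in>Pow I. \<Prod>i\<in>I. if i \<in> G then a i else b i)"
proof -
  have "(\<Prod>i\<in>I. if i \<in> G then a i else b i) = (\<Prod>i\<in>G. a i) * (\<Prod>i\<in>I - G. b i)" if "G \<subseteq> I" for G
  proof -
    have "I \<inter> G = G" "I \<inter> - G = I - G" using that by auto
    then show ?thesis using assms prod.If_cases[of I "\<lambda>i. i \<in> G" a b] by simp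
  qed
  then show ?thesis using assms by (simp add: prod_add)
qed

text \<open>Each answer equal to \<open>f\<close> has weight at least 1/3, and weight 1 if
  \<open>x = f\<close>; having fewer than \<open>q\<close> factors only helps.\<close>

lemma lik_all_lies:
  assumes "\<forall>y\<in>set r. y = f" and "length r \<le> q"
  shows "(1/3) ^ q \<le> lik x f r"
proof -
  have "(1/3 :: real) ^ q \<le> (1/3) ^ length r"
    using assms(2) by (intro power_decreasing) auto
  also have "\<dots> \<le> lik x f r"
    using assms(1)
  proof (induction r)
    case (Cons y r)
    then have "(1/3) * (1/3) ^ length r \<le> ans x f y * lik x f r"
      by (intro mult_mono) (auto simp: ans_def)
    then show ?case by (simp add: lik_def)
  qed simp
  finally show ?thesis .
qed

text \<open>A location lies with probability \<open>\<kappa>\<close>, and its fake value has distribution \<open>\<mu>\<close>.\<close>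

locale noise_model =
  fixes n :: nat and V :: "real set" and \<mu> :: "real \<Rightarrow> real" and \<kappa> :: real and q :: nat
  assumes finite_V: "finite V"
    and \<mu>_nonneg: "f \<in> V \<Longrightarrow> 0 \<le> \<mu> f"
    and sum_\<mu>: "sum \<mu> V = 1"
    and \<kappa>: "0 \<le> \<kappa>" "\<kappa> \<le> 1"
begin

definition dprob :: real where "dprob = \<kappa> * (1/3) ^ q"

text \<open>
  Likelihood of the answers \<open>r\<close> at a location with true value \<open>x\<close>: \<open>\<beta>\<close> is the total, \<open>\<delta>\<close> the part
  contributed by deceivers.
\<close>

definition \<beta> :: "real \<Rightarrow> real list \<Rightarrow> real" where
  "\<beta> x r = (1 - \<kappa>) * lik x x r + \<kappa> * (\<Sum>f\<in>V. \<mu> f * lik x f r)"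

definition \<delta> :: "real \<Rightarrow> real list \<Rightarrow> real" where
  "\<delta> x r = \<kappa> * (\<Sum>f\<in>V. \<mu> f *
     ((1/3) ^ q * of_bool (\<forall>y\<in>set (take q r). y = f) * lik x f (drop q r)))"

definition \<gamma> :: "real \<Rightarrow> real list \<Rightarrow> real" where
  "\<gamma> x r = \<beta> x r - \<delta> x r"

lemma dprob: "0 \<le> dprob" "dprob \<le> 1"
  using \<kappa> mult_le_one[OF \<kappa>(2), of "(1/3) ^ q"] by (auto simp: dprob_def power_le_one)

lemma \<beta>_Nil [simp]: "\<beta> x [] = 1"
  by (simp add: \<beta>_def sum_\<mu>)

lemma \<delta>_Nil [simp]: "\<delta> x [] = dprob"
  using sum_\<mu> by (simp add: \<delta>_def dprob_def flip: sum_distrib_right)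

lemma \<gamma>_Nil [simp]: "\<gamma> x [] = 1 - dprob"
  by (simp add: \<gamma>_def)

lemma \<delta>_nonneg: "0 \<le> \<delta> x r"
  unfolding \<delta>_def by (intro mult_nonneg_nonneg sum_nonneg \<kappa> \<mu>_nonneg lik_nonneg) auto

text \<open>For fixed \<open>f\<close>, the weight prescribed for the first \<open>q\<close> answers
  is at most their likelihood by \<open>lik_all_lies\<close>, also when fewer than \<open>q\<close>
  answers exist; the later answers contribute the same factor to both sides.\<close>

lemma \<delta>_le_\<beta>: "\<delta> x r \<le> \<beta> x r"
proof -
  have "(1/3) ^ q * of_bool (\<forall>y\<in>set (take q r). y = f) * lik x f (drop q r) \<le> lik x f r" for f
  proof -
    have "(1/3) ^ q * of_bool (\<forall>y\<in>set (take q r). y = f) \<le> lik x f (take q r)"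
      using lik_all_lies[of "take q r" f q x] by (auto simp: lik_nonneg)
    then have "(1/3) ^ q * of_bool (\<forall>y\<in>set (take q r). y = f) * lik x f (drop q r)
        \<le> lik x f (take q r) * lik x f (drop q r)"
      by (intro mult_right_mono lik_nonneg)
    then show ?thesis by (simp flip: lik_append)
  qed
  then have "\<delta> x r \<le> \<kappa> * (\<Sum>f\<in>V. \<mu> f * lik x f r)"
    unfolding \<delta>_def by (intro mult_left_mono sum_mono \<kappa> \<mu>_nonneg) auto
  also have "\<dots> \<le> \<beta> x r"
    using \<kappa> lik_nonneg by (simp add: \<beta>_def)
  finally show ?thesis .
qed

lemma \<gamma>_nonneg: "0 \<le> \<gamma> x r"
  using \<delta>_le_\<beta> by (simp add: \<gamma>_def)

text \<open>This is what hides the values. The full factor \<open>(1/3) ^ q\<close> is charged from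
  the start, as if the lies had been decided in advance, and the true value enters only through
  \<open>drop q r\<close>.\<close>

lemma \<delta>_cong: "length r \<le> q \<Longrightarrow> \<delta> x r = \<delta> x' r"
  by (simp add: \<delta>_def)

lemma sum_\<beta>_snoc:
  assumes "x \<in> V" shows "(\<Sum>y\<in>V. \<beta> x (r @ [y])) = \<beta> x r"
proof -
  have "(\<Sum>y\<in>V. \<Sum>f\<in>V. \<mu> f * lik x f (r @ [y])) = (\<Sum>f\<in>V. \<Sum>y\<in>V. \<mu> f * lik x f r * ans x f y)"
    by (subst sum.swap) (simp add: lik_snoc mult_ac)
  also have "\<dots> = (\<Sum>f\<in>V. \<mu> f * lik x f r)"
    using assms finite_V by (intro sum.cong refl) (simp add: sum_ans flip: sum_distrib_left)
  finally show ?thesis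
    using assms finite_V
    by (simp add: \<beta>_def sum.distrib lik_snoc sum_ans flip: sum_distrib_left)
qed

text \<open>Before \<open>q\<close> answers are given a deceiver can only repeat its fake, which
  keeps the whole weight because its factor 1/3 is already paid; from then on the weights
  \<open>ans\<close> sum to 1.\<close>

lemma sum_\<delta>_snoc:
  assumes "x \<in> V" shows "(\<Sum>y\<in>V. \<delta> x (r @ [y])) = \<delta> x r"
proof -
  define d where "d f r = (1/3) ^ q * of_bool (\<forall>y\<in>set (take q r). y = f) * lik x f (drop q r)"
    for f and r :: "real list"
  have d: "(\<Sum>y\<in>V. d f (r @ [y])) = d f r" if "f \<in> V" for f
  proof (cases "q \<le> length r")
    case True
    then show ?thesis using sum_ans[OF finite_V assms that]
      by (simp add: d_def lik_snoc flip: sum_distrib_left)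
  next
    case False
    then have "(\<Sum>y\<in>V. d f (r @ [y])) = (\<Sum>y\<in>V. if y = f then d f r else 0)"
      by (intro sum.cong) (auto simp: d_def)
    then show ?thesis using that finite_V by simp
  qed
  have "(\<Sum>y\<in>V. \<delta> x (r @ [y])) = \<kappa> * (\<Sum>y\<in>V. \<Sum>f\<in>V. \<mu> f * d f (r @ [y]))"
    by (simp add: \<delta>_def d_def sum_distrib_left)
  also have "(\<Sum>y\<in>V. \<Sum>f\<in>V. \<mu> f * d f (r @ [y])) = (\<Sum>f\<in>V. \<mu> f * d f r)"
    by (subst sum.swap) (simp add: d flip: sum_distrib_left)
  finally show ?thesis by (simp add: \<delta>_def d_def)
qed

lemma sum_\<gamma>_snoc: "x \<in> V \<Longrightarrow> (\<Sum>y\<in>V. \<gamma> x (r @ [y])) = \<gamma> x r"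
  by (simp add: \<gamma>_def sum_subtractf sum_\<beta>_snoc sum_\<delta>_snoc)

text \<open>Likelihood of the history together with \<open>G\<close> being the set of deceivers.\<close>

definition joint :: "nat set \<Rightarrow> real list \<Rightarrow> history \<Rightarrow> real" where
  "joint G ys h = (\<Prod>i<n. if i \<in> G then \<delta> (ys ! i) (resp i h) else \<gamma> (ys ! i) (resp i h))"

definition late :: "history \<Rightarrow> nat set" where
  "late h = {i. i < n \<and> q < length (resp i h)}"

lemma joint_nonneg: "0 \<le> joint G ys h"
  by (auto simp: joint_def intro!: prod_nonneg \<delta>_nonneg \<gamma>_nonneg)

lemma joint_Nil: "joint G ys [] = (\<Prod>i<n. if i \<in> G then dprob else 1 - dprob)"
  by (simp add: joint_def cong: if_cong)

text \<open>At each location \<open>\<beta>\<close> splits into \<open>\<delta>\<close> and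
  \<open>\<gamma>\<close>; summing over \<open>G\<close> forgets which locations are
  deceivers.\<close>

lemma sum_joint: "(\<Sum>G\<in>Pow {..<n}. joint G ys h) = (\<Prod>i<n. \<beta> (ys ! i) (resp i h))"
proof -
  have "(\<Prod>i<n. \<beta> (ys ! i) (resp i h)) = (\<Prod>i<n. \<delta> (ys ! i) (resp i h) + \<gamma> (ys ! i) (resp i h))"
    by (simp add: \<gamma>_def)
  then show ?thesis by (simp add: joint_def prod_add_Pow_if)
qed

lemma sum_joint_snoc:
  assumes "i < n" "ys ! i \<in> V"
  shows "(\<Sum>y\<in>V. joint G ys (h @ [(i, y)])) = joint G ys h"
  unfolding joint_def
  using assms
  by (intro sum_prod_resp_snoc[where \<phi> = "\<lambda>j r. if j \<in> G then \<delta> (ys ! j) r else \<gamma> (ys ! j) r"])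
     (auto simp: sum_\<delta>_snoc sum_\<gamma>_snoc)

lemma late_snoc:
  "i < n \<Longrightarrow> late (h @ [(i, y)]) = (if length (resp i h) = q then insert i (late h) else late h)"
  by (auto simp: late_def resp_snoc split: if_splits)

lemma late_Nil [simp]: "late [] = {}"
  by (simp add: late_def)

lemma late_subset: "late h \<subseteq> {..<n}"
  by (auto simp: late_def)

lemma finite_late [simp]: "finite (late h)"
  using finite_subset[OF late_subset] by simp

lemma card_late_le: "(q + 1) * card (late h) \<le> length h"
proof -
  have "(q + 1) * card (late h) = (\<Sum>i\<in>late h. q + 1)" by simp
  also have "\<dots> \<le> (\<Sum>i\<in>late h. length (resp i h))"
    by (intro sum_mono) (auto simp: late_def)
  also have "\<dots> \<le> length h" by (rule sum_length_resp_le) simp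
  finally show ?thesis .
qed

text \<open>\<open>None\<close> marks an honest location and \<open>Some f\<close> a liar with fake
  \<open>f\<close>; \<open>PiE\<close> keeps the family finite.\<close>

definition fakes :: "(nat \<Rightarrow> real option) set" where
  "fakes = PiE {..<n} (\<lambda>_. insert None (Some ` V))"

definition fake_weight :: "(nat \<Rightarrow> real option) \<Rightarrow> real" where
  "fake_weight c = (\<Prod>i<n. case c i of None \<Rightarrow> 1 - \<kappa> | Some f \<Rightarrow> \<kappa> * \<mu> f)"

text \<open>At an honest location the adversary itself tells the truth, which is why it has to know
  \<open>ys\<close>.\<close>

definition fake_of :: "real list \<Rightarrow> (nat \<Rightarrow> real option) \<Rightarrow> nat \<Rightarrow> real" where
  "fake_of ys c i = (case c i of None \<Rightarrow> ys ! i | Some f \<Rightarrow> f)"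

definition fake_adv :: "real list \<Rightarrow> (nat \<Rightarrow> real option) \<Rightarrow> adversary" where
  "fake_adv ys c = (\<lambda>h i. return_pmf (fake_of ys c i))"

lemma finite_fakes: "finite fakes"
  using finite_V by (auto simp: fakes_def intro: finite_PiE)

lemma fakesD: "c \<in> fakes \<Longrightarrow> i < n \<Longrightarrow> c i = Some f \<Longrightarrow> f \<in> V"
  by (force simp: fakes_def PiE_iff)

lemma fake_weight_nonneg: "c \<in> fakes \<Longrightarrow> 0 \<le> fake_weight c"
  unfolding fake_weight_def
  by (intro prod_nonneg) (auto simp: \<kappa> split: option.split intro!: mult_nonneg_nonneg \<mu>_nonneg dest: fakesD)

lemma sum_option: "(\<Sum>c\<in>insert None (Some ` V). g c) = g None + (\<Sum>f\<in>V. g (Some f))"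
  for g :: "real option \<Rightarrow> real"
  using finite_V by (subst sum.insert) (auto simp: sum.reindex)

text \<open>Exchanging the sum over assignments with the product over locations leaves one mixture
  per location, which is \<open>\<beta>\<close>.\<close>

lemma sum_fakes:
  "(\<Sum>c\<in>fakes. fake_weight c * (\<Prod>i<n. lik (ys ! i) (fake_of ys c i) (resp i h))) =
   (\<Sum>G\<in>Pow {..<n}. joint G ys h)"
proof -
  let ?g = "\<lambda>i o'. case o' of None \<Rightarrow> (1 - \<kappa>) * lik (ys ! i) (ys ! i) (resp i h)
     | Some f \<Rightarrow> \<kappa> * \<mu> f * lik (ys ! i) f (resp i h)"
  have "(\<Sum>c\<in>fakes. fake_weight c * (\<Prod>i<n. lik (ys ! i) (fake_of ys c i) (resp i h))) =
      (\<Sum>c\<in>fakes. \<Prod>i<n. ?g i (c i))"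
    unfolding fake_weight_def prod.distrib[symmetric] fake_of_def
    by (intro sum.cong prod.cong) (auto split: option.split)
  also have "\<dots> = (\<Prod>i<n. \<Sum>c\<in>insert None (Some ` V). ?g i c)"
    unfolding fakes_def using finite_V by (subst prod_sum_PiE) auto
  also have "\<dots> = (\<Prod>i<n. \<beta> (ys ! i) (resp i h))"
    unfolding sum_option by (simp add: \<beta>_def sum_distrib_left mult_ac)
  finally show ?thesis by (simp add: sum_joint)
qed

lemma sum_fake_weight: "(\<Sum>c\<in>fakes. fake_weight c) = 1"
  using sum_fakes[of ys "[]"] by (simp add: sum_joint)

text \<open>The bridge from guarantees against every single \<open>fake_adv ys c\<close> to path
  sums weighted by \<open>joint\<close>: such guarantees survive averaging over the assignments
  \<open>c\<close>.\<close>

lemma sum_nn_integral_run: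
  assumes A: "algorithm_on n A" and ys: "\<And>i. i < n \<Longrightarrow> ys ! i \<in> V"
  shows "(\<Sum>c\<in>fakes. ennreal (fake_weight c) * (\<integral>\<^sup>+ s. \<phi> s \<partial>measure_pmf (run A (fake_adv ys c) ys t))) =
    path_sum A V t (\<lambda>s. ennreal (\<Sum>G\<in>Pow {..<n}. joint G ys (fst s)) * \<phi> s)"
proof -
  have f: "fake_of ys c i \<in> V" if "c \<in> fakes" "i < n" for c i
    using that ys by (auto simp: fake_of_def split: option.split dest: fakesD)
  have "(\<Sum>c\<in>fakes. ennreal (fake_weight c) * (\<integral>\<^sup>+ s. \<phi> s \<partial>measure_pmf (run A (fake_adv ys c) ys t))) =
     (\<Sum>c\<in>fakes. path_sum A V t (\<lambda>s. ennreal (fake_weight c) *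
        (ennreal (\<Prod>i<n. lik (ys ! i) (fake_of ys c i) (resp i (fst s))) * \<phi> s)))"
    unfolding fake_adv_def path_sum_cmult using A finite_V ys f
    by (intro sum.cong arg_cong2[where f = "(*)"] refl nn_integral_run) auto
  also have "\<dots> = path_sum A V t (\<lambda>s. \<Sum>c\<in>fakes. ennreal (fake_weight c) *
        (ennreal (\<Prod>i<n. lik (ys ! i) (fake_of ys c i) (resp i (fst s))) * \<phi> s))"
    by (rule path_sum_sum[symmetric]) (rule finite_fakes)
  also have "\<dots> = path_sum A V t (\<lambda>s. ennreal (\<Sum>G\<in>Pow {..<n}. joint G ys (fst s)) * \<phi> s)"
  proof (intro arg_cong[where f = "path_sum A V t"] ext)
    fix s
    have "(\<Sum>c\<in>fakes. ennreal (fake_weight c) *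
        (ennreal (\<Prod>i<n. lik (ys ! i) (fake_of ys c i) (resp i (fst s))) * \<phi> s)) =
      (\<Sum>c\<in>fakes. ennreal (fake_weight c * (\<Prod>i<n. lik (ys ! i) (fake_of ys c i) (resp i (fst s))))) * \<phi> s"
      unfolding sum_distrib_right
      by (intro sum.cong refl) (simp add: ennreal_mult fake_weight_nonneg prod_nonneg lik_nonneg mult.assoc)
    also have "\<dots> = ennreal (\<Sum>c\<in>fakes. fake_weight c * (\<Prod>i<n. lik (ys ! i) (fake_of ys c i) (resp i (fst s)))) * \<phi> s"
      by (subst sum_ennreal) (auto intro!: mult_nonneg_nonneg fake_weight_nonneg prod_nonneg lik_nonneg)
    finally show "(\<Sum>c\<in>fakes. ennreal (fake_weight c) *
        (ennreal (\<Prod>i<n. lik (ys ! i) (fake_of ys c i) (resp i (fst s))) * \<phi> s)) =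
        ennreal (\<Sum>G\<in>Pow {..<n}. joint G ys (fst s)) * \<phi> s"
      by (simp add: sum_fakes)
  qed
  finally show ?thesis .
qed

end

section \<open>Random permutations and the exchange of deceivers\<close>

locale noise_instance = noise_model +
  fixes xs :: "real list"
  assumes length_xs: "length xs = n" and set_xs: "set xs \<subseteq> V"
begin

definition perms :: "real list set" where "perms = {ys. mset ys = mset xs}"

definition swapped :: "nat \<Rightarrow> nat \<Rightarrow> real list \<Rightarrow> real list" where
  "swapped i j ys = permute_list (Transposition.transpose i j) ys"

lemma perms_eq: "perms = permutations_of_multiset (mset xs)"
  by (simp add: perms_def permutations_of_multiset_def)

lemma finite_perms: "finite perms"
  by (simp add: perms_eq)

lemma perms_length: "ys \<in> perms \<Longrightarrow> length ys = n"
  using length_xs by (auto simp: perms_def dest: mset_eq_length)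

lemma perms_nth: "ys \<in> perms \<Longrightarrow> i < n \<Longrightarrow> ys ! i \<in> V"
  using set_xs perms_length mset_eq_setD nth_mem unfolding perms_def by blast

lemma transpose_permutes: "i < n \<Longrightarrow> j < n \<Longrightarrow> Transposition.transpose i j permutes {..<n}"
  by (intro permutes_swap_id) auto

lemma swapped_in_perms: "ys \<in> perms \<Longrightarrow> i < n \<Longrightarrow> j < n \<Longrightarrow> swapped i j ys \<in> perms"
  using mset_permute_list[of "Transposition.transpose i j" ys] transpose_permutes[of i j] perms_length[of ys]
  by (simp add: swapped_def perms_def)

lemma swapped_nth: "ys \<in> perms \<Longrightarrow> i < n \<Longrightarrow> j < n \<Longrightarrow> m < n \<Longrightarrow> swapped i j ys ! m = ys ! Transposition.transpose i j m"
  using permute_list_nth[of "Transposition.transpose i j" ys] transpose_permutes[of i j] perms_length[of ys]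
  by (simp add: swapped_def)

lemma swapped_swapped: "ys \<in> perms \<Longrightarrow> i < n \<Longrightarrow> j < n \<Longrightarrow> swapped i j (swapped i j ys) = ys"
  using permute_list_compose[of "Transposition.transpose i j" ys "Transposition.transpose i j"] transpose_permutes[of i j]
    perms_length[of ys]
  by (simp add: swapped_def)

lemma sum_perms_swapped:
  assumes "i < n" "j < n"
  shows "(\<Sum>ys\<in>perms. F (swapped i j ys)) = (\<Sum>ys\<in>perms. F ys)"
  using assms by (intro sum.reindex_bij_witness[of _ "swapped i j" "swapped i j"]) (auto simp: swapped_swapped swapped_in_perms)

text \<open>The two altered values enter only through \<open>\<delta>\<close> at locations with at
  most \<open>q\<close> answers, where \<open>\<delta>_cong\<close> makes them invisible.\<close>

lemma joint_swapped:
  assumes "ys \<in> perms" "G \<subseteq> {..<n}" "i \<in> G - late h" "j \<in> G - late h"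
  shows "joint G (swapped i j ys) h = joint G ys h"
  unfolding joint_def
proof (intro prod.cong refl)
  fix m assume m: "m \<in> {..<n}"
  have ij: "i < n" "j < n" using assms by auto
  show "(if m \<in> G then \<delta> (swapped i j ys ! m) (resp m h) else \<gamma> (swapped i j ys ! m) (resp m h)) =
      (if m \<in> G then \<delta> (ys ! m) (resp m h) else \<gamma> (ys ! m) (resp m h))"
  proof (cases "m = i \<or> m = j")
    case True
    then have "length (resp m h) \<le> q" "m \<in> G" using assms m by (auto simp: late_def)
    then show ?thesis using \<delta>_cong by auto
  next
    case False
    then show ?thesis using swapped_nth[OF assms(1) ij, of m] m by (auto simp: Transposition.transpose_def)
  qed
qed

definition hits :: "(real \<Rightarrow> bool) \<Rightarrow> nat set \<Rightarrow> real list \<Rightarrow> real" where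
  "hits P G ys = (\<Sum>m\<in>G. of_bool (P (ys ! m)))"

lemma hits_nonneg: "0 \<le> hits P G ys"
  by (simp add: hits_def sum_nonneg)

lemma hits_mono: "finite H \<Longrightarrow> G \<subseteq> H \<Longrightarrow> hits P G ys \<le> hits P H ys"
  unfolding hits_def by (rule sum_mono2) auto

lemma hits_eq_0_iff: "finite G \<Longrightarrow> hits P G ys = 0 \<longleftrightarrow> (\<forall>i\<in>G. \<not> P (ys ! i))"
  unfolding hits_def by (subst sum_nonneg_eq_0_iff) auto

lemma hits_swapped:
  assumes "ys \<in> perms" "G \<subseteq> {..<n}" "i \<in> G" "j \<in> G"
  shows "hits P G (swapped i j ys) = hits P G ys"
proof -
  have "hits P G (swapped i j ys) = (\<Sum>m\<in>G. of_bool (P (ys ! Transposition.transpose i j m)))"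
    unfolding hits_def using assms by (intro sum.cong) (auto simp: subset_eq swapped_nth)
  also have "\<dots> = hits P G ys"
    unfolding hits_def using sum.permute[OF permutes_swap_id[OF assms(3,4)], of "\<lambda>m. of_bool (P (ys ! m)) :: real"]
    by (simp add: o_def)
  finally show ?thesis .
qed

text \<open>Swapping shows that all members of \<open>G - late h\<close> get the same share of
  \<open>P\<close>, since \<open>hits P G\<close> is invariant. The shares add up to at most 1, and
  there are at least \<open>card G - m0\<close> of them.\<close>

lemma sum_joint_exchange:
  assumes G: "G \<subseteq> {..<n}" and i: "i \<in> G - late h" and c: "card (G \<inter> late h) \<le> m0" and m0: "m0 < card G"
  shows "(\<Sum>ys\<in>perms. joint G ys h * (of_bool (P (ys ! i)) / hits P G ys))
    \<le> (\<Sum>ys\<in>perms. joint G ys h * of_bool (0 < hits P G ys)) / (real (card G) - real m0)"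
proof -
  have fG: "finite G" using G finite_subset by blast
  let ?X = "\<lambda>j. \<Sum>ys\<in>perms. joint G ys h * (of_bool (P (ys ! j)) / hits P G ys)"
  have eq: "?X j = ?X i" if j: "j \<in> G - late h" for j
  proof -
    have ij: "i < n" "j < n" using i j G by auto
    have "?X i = (\<Sum>ys\<in>perms. joint G (swapped i j ys) h * (of_bool (P (swapped i j ys ! i)) / hits P G (swapped i j ys)))"
      using sum_perms_swapped[OF ij, of "\<lambda>ys. joint G ys h * (of_bool (P (ys ! i)) / hits P G ys)"] by simp
    also have "\<dots> = ?X j"
      using i j G ij by (intro sum.cong) (auto simp: joint_swapped hits_swapped swapped_nth)
    finally show ?thesis by simp
  qed
  have X0: "0 \<le> ?X i" by (intro sum_nonneg mult_nonneg_nonneg joint_nonneg) (auto simp: hits_nonneg)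
  have "real (card G) - real m0 \<le> real (card (G - late h))"
    using c m0 card_Diff_subset_Int[of G "late h"] fG by simp
  then have "(real (card G) - real m0) * ?X i \<le> real (card (G - late h)) * ?X i"
    using X0 by (rule mult_right_mono)
  also have "\<dots> = (\<Sum>j\<in>G - late h. ?X j)"
    using eq by simp
  also have "\<dots> = (\<Sum>ys\<in>perms. joint G ys h * (hits P (G - late h) ys / hits P G ys))"
    by (subst sum.swap) (simp add: hits_def sum_distrib_left[symmetric] sum_divide_distrib[symmetric])
  also have "\<dots> \<le> (\<Sum>ys\<in>perms. joint G ys h * of_bool (0 < hits P G ys))"
  proof (intro sum_mono mult_left_mono joint_nonneg)
    fix ys
    \<comment> \<open>If no member of \<open>G\<close> has \<open>P\<close>, the quotient is 0
      because division by zero gives 0.\<close>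
    show "hits P (G - late h) ys / hits P G ys \<le> of_bool (0 < hits P G ys)"
      using hits_mono[OF fG, of "G - late h" P ys] hits_nonneg[of P G ys]
      by (cases "hits P G ys = 0") (auto simp: divide_le_eq)
  qed
  finally show ?thesis using m0 by (simp add: pos_le_divide_eq mult.commute)
qed

text \<open>
  Each deceiver that becomes late is one with property \<open>P\<close> at most as often as a random element
  of a set of size \<open>card G - m0\<close>, so this potential is a supermartingale while at most \<open>m0\<close>
  deceivers are late.
\<close>

definition late_potential :: "(real \<Rightarrow> bool) \<Rightarrow> nat \<Rightarrow> nat set \<Rightarrow> real list \<Rightarrow> nat set \<Rightarrow> real" where
  "late_potential P m0 G ys L = of_bool (card (G \<inter> L) \<le> m0) * (hits P (G \<inter> L) ys / hits P G ys
     + of_bool (0 < hits P G ys) * ((real m0 - real (card (G \<inter> L))) / (real (card G) - real m0)))"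

lemma late_potential_nonneg: "m0 < card G \<Longrightarrow> 0 \<le> late_potential P m0 G ys L"
  by (auto simp: late_potential_def hits_nonneg)

text \<open>Adding \<open>i\<close> raises the first term by
  \<open>of_bool (P (ys ! i)) / hits P G ys\<close> and uses up one unit of the remaining allowance;
  by \<open>sum_joint_exchange\<close> the gain does not exceed the loss on average over the
  permutations.\<close>

lemma sum_joint_late_potential_insert:
  assumes G: "G \<subseteq> {..<n}" and i: "i \<in> G - late h" and m0: "m0 < card G"
  shows "(\<Sum>ys\<in>perms. joint G ys h * late_potential P m0 G ys (insert i (late h)))
    \<le> (\<Sum>ys\<in>perms. joint G ys h * late_potential P m0 G ys (late h))"
proof (cases "card (G \<inter> late h) + 1 \<le> m0")
  \<comment> \<open>The allowance \<open>m0\<close> is exceeded, and the leading indicator cuts the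
    potential to 0.\<close>
  case False
  have "finite (G \<inter> late h)" by simp
  then have "card (G \<inter> insert i (late h)) = card (G \<inter> late h) + 1" using i by simp
  then have "late_potential P m0 G ys (insert i (late h)) = 0" for ys using False by (simp add: late_potential_def)
  then show ?thesis by (simp add: sum_nonneg joint_nonneg late_potential_nonneg[OF m0])
next
  case True
  have fG: "finite G" using G finite_subset by blast
  have GI: "G \<inter> insert i (late h) = insert i (G \<inter> late h)" using i by auto
  have c: "card (G \<inter> insert i (late h)) = card (G \<inter> late h) + 1"
    using i by (simp add: GI)
  have NI: "hits P (G \<inter> insert i (late h)) ys = hits P (G \<inter> late h) ys + of_bool (P (ys ! i))" for ys
    using i by (simp add: GI hits_def)
  have "late_potential P m0 G ys (insert i (late h)) = late_potential P m0 G ys (late h)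
      + (of_bool (P (ys ! i)) / hits P G ys - of_bool (0 < hits P G ys) / (real (card G) - real m0))" for ys
    using True by (simp add: late_potential_def c NI add_divide_distrib diff_divide_distrib)
  then have "(\<Sum>ys\<in>perms. joint G ys h * late_potential P m0 G ys (insert i (late h))) =
      (\<Sum>ys\<in>perms. joint G ys h * late_potential P m0 G ys (late h))
      + ((\<Sum>ys\<in>perms. joint G ys h * (of_bool (P (ys ! i)) / hits P G ys))
        - (\<Sum>ys\<in>perms. joint G ys h * of_bool (0 < hits P G ys)) / (real (card G) - real m0))"
    by (simp add: distrib_left right_diff_distrib sum.distrib sum_subtractf sum_divide_distrib)
  then show ?thesis using sum_joint_exchange[OF G i _ m0, of P] True by simp
qed

text \<open>Once all members with \<open>P\<close> are late, the first term of the potential is 1,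
  whereas its initial value is at most \<open>m0 / (card G - m0)\<close>; the supermartingale bound
  compares the two.\<close>

lemma path_sum_all_late:
  assumes A: "algorithm_on n A" and G: "G \<subseteq> {..<n}" and m0: "m0 < card G"
  shows "path_sum A V t (\<lambda>s. ennreal (\<Sum>ys\<in>perms. joint G ys (fst s) *
       of_bool (card (G \<inter> late (fst s)) \<le> m0 \<and> (\<exists>i\<in>G. P (ys ! i)) \<and> (\<forall>i\<in>G. P (ys ! i) \<longrightarrow> i \<in> late (fst s)))))
    \<le> ennreal (real m0 / (real (card G) - real m0) * (\<Sum>ys\<in>perms. joint G ys []))"
proof -
  have fG: "finite G" using G finite_subset by blast
  let ?W = "\<lambda>h. ennreal (\<Sum>ys\<in>perms. joint G ys h * late_potential P m0 G ys (late h))"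
  have super: "(\<Sum>y\<in>V. ?W (h @ [(i, y)])) \<le> ?W h" if i: "i < n" for h i
  proof -
    \<comment> \<open>\<open>L\<close> does not depend on the answer, so the potential stays fixed
      while \<open>joint\<close> is summed over \<open>y\<close>.\<close>
    define L where "L = (if length (resp i h) = q then insert i (late h) else late h)"
    have L: "late (h @ [(i, y)]) = L" for y using i by (simp add: late_snoc L_def)
    have "(\<Sum>y\<in>V. ?W (h @ [(i, y)])) =
        ennreal (\<Sum>y\<in>V. \<Sum>ys\<in>perms. joint G ys (h @ [(i, y)]) * late_potential P m0 G ys L)"
      unfolding L by (subst sum_ennreal) (auto intro!: sum_nonneg mult_nonneg_nonneg joint_nonneg late_potential_nonneg[OF m0])
    also have "(\<Sum>y\<in>V. \<Sum>ys\<in>perms. joint G ys (h @ [(i, y)]) * late_potential P m0 G ys L)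
       = (\<Sum>ys\<in>perms. joint G ys h * late_potential P m0 G ys L)"
      by (subst sum.swap) (auto simp: sum_distrib_right[symmetric] sum_joint_snoc i perms_nth intro!: sum.cong)
    also have "\<dots> \<le> (\<Sum>ys\<in>perms. joint G ys h * late_potential P m0 G ys (late h))"
    proof (cases "length (resp i h) = q \<and> i \<in> G")
      case True
      then show ?thesis using sum_joint_late_potential_insert[OF G _ m0, of i h P] by (auto simp: L_def late_def)
    next
      case False
      then have "G \<inter> L = G \<inter> late h" by (auto simp: L_def)
      then show ?thesis by (simp add: late_potential_def)
    qed
    finally show ?thesis by (simp add: ennreal_leI)
  qed
  have "path_sum A V t (\<lambda>s. ennreal (\<Sum>ys\<in>perms. joint G ys (fst s) *
       of_bool (card (G \<inter> late (fst s)) \<le> m0 \<and> (\<exists>i\<in>G. P (ys ! i)) \<and> (\<forall>i\<in>G. P (ys ! i) \<longrightarrow> i \<in> late (fst s)))))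
     \<le> path_sum A V t (\<lambda>s. ?W (fst s))"
  proof (intro path_sum_mono ennreal_leI sum_mono mult_left_mono joint_nonneg)
    fix s :: "history \<times> nat set option" and ys
    let ?L = "late (fst s)"
    show "of_bool (card (G \<inter> ?L) \<le> m0 \<and> (\<exists>i\<in>G. P (ys ! i)) \<and> (\<forall>i\<in>G. P (ys ! i) \<longrightarrow> i \<in> ?L)) \<le> late_potential P m0 G ys ?L"
    proof (cases "card (G \<inter> ?L) \<le> m0 \<and> (\<exists>i\<in>G. P (ys ! i)) \<and> (\<forall>i\<in>G. P (ys ! i) \<longrightarrow> i \<in> ?L)")
      case True
      have "hits P (G \<inter> ?L) ys = hits P G ys"
        unfolding hits_def using True fG by (intro sum.mono_neutral_left) auto
      moreover have "hits P G ys \<noteq> 0" using True fG by (auto simp: hits_eq_0_iff)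
      ultimately show ?thesis using True m0 by (simp add: late_potential_def)
    qed (use late_potential_nonneg[OF m0, of P ys ?L] in auto)
  qed
  also have "\<dots> \<le> ?W []"
    by (rule path_sum_supermartingale[OF A super])
  also have "\<dots> \<le> ennreal (real m0 / (real (card G) - real m0) * (\<Sum>ys\<in>perms. joint G ys []))"
    unfolding sum_distrib_left using m0
    by (intro ennreal_leI sum_mono) (auto simp: late_potential_def hits_def joint_nonneg mult.commute intro!: mult_right_mono)
  finally show ?thesis .
qed

text \<open>If \<open>S\<close> is right for an instance with a high \<open>i\<close> and a low
  \<open>j\<close> among the deceivers that are not late, it is wrong for the equally weighted
  instance with these two values exchanged. So at most half of the weight of \<open>b\<close> is
  answered correctly; outside \<open>b\<close> nothing is claimed.\<close>

lemma sum_joint_correct_le: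
  fixes v :: real and h :: history
  assumes G: "G \<subseteq> {..<n}"
  defines "b \<equiv> \<lambda>ys. (\<exists>i\<in>G - late h. v \<le> ys ! i) \<and> (\<exists>j\<in>G - late h. \<not> v \<le> ys ! j)"
  shows "2 * (\<Sum>ys\<in>perms. joint G ys h * of_bool (S = threshold_set v ys))
    \<le> (\<Sum>ys\<in>perms. joint G ys h) + (\<Sum>ys\<in>perms. joint G ys h * of_bool (\<not> b ys))"
proof -
  have "2 * (\<Sum>ys\<in>perms. joint G ys h * of_bool (S = threshold_set v ys \<and> b ys))
      \<le> (\<Sum>ys\<in>perms. joint G ys h * of_bool (b ys))"
  proof (cases "\<exists>ys\<in>perms. S = threshold_set v ys \<and> b ys")
    case False
    then have "(\<Sum>ys\<in>perms. joint G ys h * of_bool (S = threshold_set v ys \<and> b ys)) = 0"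
      by (intro sum.neutral) auto
    then show ?thesis by (simp add: sum_nonneg joint_nonneg)
  next
    case True
    \<comment> \<open>One witness suffices: \<open>S\<close> contains \<open>i\<close> but not
      \<open>j\<close>, so the same swap works for every instance that \<open>S\<close> answers
      correctly.\<close>
    then obtain zs i j where zs: "zs \<in> perms" "S = threshold_set v zs"
        and i: "i \<in> G - late h" "v \<le> zs ! i" and j: "j \<in> G - late h" "\<not> v \<le> zs ! j"
      by (auto simp: b_def)
    have ij: "i < n" "j < n" using i j G by auto
    have S: "i \<in> S" "j \<notin> S" using zs i j ij by (auto simp: threshold_set_def perms_length)
    have hi: "m \<in> threshold_set v ys \<longleftrightarrow> v \<le> ys ! m" if "ys \<in> perms" "m < n" for ys m
      using that by (simp add: threshold_set_def perms_length)
    have bS: "b ys" if "ys \<in> perms" "S = threshold_set v ys" for ys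
      using i j S that hi[OF that(1)] ij unfolding b_def by blast
    have bS': "b ys \<and> S \<noteq> threshold_set v ys" if ys: "ys \<in> perms" "S = threshold_set v (swapped i j ys)" for ys
    proof -
      have "v \<le> swapped i j ys ! i" "\<not> v \<le> swapped i j ys ! j"
        using S ys hi[OF swapped_in_perms[OF ys(1) ij]] ij by auto
      then have "v \<le> ys ! j" "\<not> v \<le> ys ! i" using swapped_nth[OF ys(1) ij] ij by auto
      then show ?thesis using i j S hi[OF ys(1)] ij unfolding b_def by blast
    qed
    have "(\<Sum>ys\<in>perms. joint G ys h * of_bool (S = threshold_set v ys \<and> b ys)) =
        (\<Sum>ys\<in>perms. joint G ys h * of_bool (S = threshold_set v ys))"
      using bS by (intro sum.cong) auto
    moreover have "\<dots> = (\<Sum>ys\<in>perms. joint G (swapped i j ys) h * of_bool (S = threshold_set v (swapped i j ys)))"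
      by (rule sum_perms_swapped[OF ij, symmetric])
    moreover have "\<dots> = (\<Sum>ys\<in>perms. joint G ys h * of_bool (S = threshold_set v (swapped i j ys)))"
      using i j G by (intro sum.cong) (auto simp: joint_swapped)
    ultimately have "2 * (\<Sum>ys\<in>perms. joint G ys h * of_bool (S = threshold_set v ys \<and> b ys)) =
        (\<Sum>ys\<in>perms. joint G ys h * (of_bool (S = threshold_set v ys) + of_bool (S = threshold_set v (swapped i j ys))))"
      by (simp add: distrib_left sum.distrib)
    also have "\<dots> \<le> (\<Sum>ys\<in>perms. joint G ys h * of_bool (b ys))"
      using bS bS' by (intro sum_mono mult_left_mono joint_nonneg) fastforce
    finally show ?thesis .
  qed
  moreover have "(\<Sum>ys\<in>perms. joint G ys h * of_bool (S = threshold_set v ys))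
      \<le> (\<Sum>ys\<in>perms. joint G ys h * of_bool (S = threshold_set v ys \<and> b ys)) + (\<Sum>ys\<in>perms. joint G ys h * of_bool (\<not> b ys))"
    unfolding sum.distrib[symmetric] distrib_left[symmetric] by (intro sum_mono mult_left_mono joint_nonneg) auto
  moreover have "(\<Sum>ys\<in>perms. joint G ys h) = (\<Sum>ys\<in>perms. joint G ys h * of_bool (b ys)) + (\<Sum>ys\<in>perms. joint G ys h * of_bool (\<not> b ys))"
    unfolding sum.distrib[symmetric] distrib_left[symmetric] by (intro sum.cong) auto
  ultimately show ?thesis by linarith
qed

end

section \<open>Independent values and exponential tilting\<close>

lemma sum_lists_prod:
  fixes F :: "nat \<Rightarrow> 'a \<Rightarrow> real"
  assumes "finite V"
  shows "(\<Sum>ys | set ys \<subseteq> V \<and> length ys = n. \<Prod>i<n. F i (ys ! i)) = (\<Prod>i<n. \<Sum>x\<in>V. F i x)"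
proof (induction n)
  case 0
  have "{ys. set ys \<subseteq> V \<and> length ys = 0} = {[]}" by auto
  then show ?case by simp
next
  case (Suc n)
  let ?L = "\<lambda>n. {ys. set ys \<subseteq> V \<and> length ys = n}"
  have "(\<Sum>ys\<in>?L (Suc n). \<Prod>i<Suc n. F i (ys ! i)) =
      (\<Sum>(ys, x)\<in>?L n \<times> V. (\<Prod>i<n. F i (ys ! i)) * F n x)"
  proof (rule sum.reindex_bij_witness[of _ "\<lambda>(ys, x). ys @ [x]" "\<lambda>ys. (butlast ys, last ys)"])
    fix ys assume ys: "ys \<in> ?L (Suc n)"
    then have ne: "ys \<noteq> []" by auto
    show "(case (butlast ys, last ys) of (ys, x) \<Rightarrow> ys @ [x]) = ys" using ne by simp
    show "(butlast ys, last ys) \<in> ?L n \<times> V"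
      using ys ne last_in_set[OF ne] by (auto dest: in_set_butlastD)
    show "(case (butlast ys, last ys) of (ys, x) \<Rightarrow> (\<Prod>i<n. F i (ys ! i)) * F n x) = (\<Prod>i<Suc n. F i (ys ! i))"
      using ys ne by (auto simp: nth_butlast last_conv_nth intro!: prod.cong)
  qed auto
  also have "\<dots> = (\<Sum>ys\<in>?L n. \<Prod>i<n. F i (ys ! i)) * (\<Sum>x\<in>V. F n x)"
    by (simp add: sum.cartesian_product[symmetric] sum_product)
  finally show ?case using Suc by simp
qed

context noise_model
begin

text \<open>Mixtures over a true value drawn from \<open>\<mu>\<close>: the likelihoods in the model
  where the values at the locations are independent.\<close>

definition \<beta>\<^sub>0 :: "real list \<Rightarrow> real" where "\<beta>\<^sub>0 r = (\<Sum>x\<in>V. \<mu> x * \<beta> x r)"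
definition \<delta>\<^sub>0 :: "real list \<Rightarrow> real" where "\<delta>\<^sub>0 r = (\<Sum>x\<in>V. \<mu> x * \<delta> x r)"

definition \<rho> :: real where "\<rho> = dprob / (1 - \<kappa>)"

lemma \<rho>_nonneg: "0 \<le> \<rho>"
  using dprob \<kappa> by (simp add: \<rho>_def)

lemma \<delta>\<^sub>0_nonneg: "0 \<le> \<delta>\<^sub>0 r"
  by (simp add: \<delta>\<^sub>0_def sum_nonneg \<mu>_nonneg \<delta>_nonneg)

lemma \<delta>\<^sub>0_le_\<beta>\<^sub>0: "\<delta>\<^sub>0 r \<le> \<beta>\<^sub>0 r"
  by (auto simp: \<delta>\<^sub>0_def \<beta>\<^sub>0_def intro!: sum_mono mult_left_mono \<mu>_nonneg \<delta>_le_\<beta>)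

lemma sum_\<beta>\<^sub>0_snoc: "(\<Sum>y\<in>V. \<beta>\<^sub>0 (r @ [y])) = \<beta>\<^sub>0 r"
  unfolding \<beta>\<^sub>0_def by (subst sum.swap) (simp add: sum_\<beta>_snoc flip: sum_distrib_left)

lemma sum_\<delta>\<^sub>0_snoc: "(\<Sum>y\<in>V. \<delta>\<^sub>0 (r @ [y])) = \<delta>\<^sub>0 r"
  unfolding \<delta>\<^sub>0_def by (subst sum.swap) (simp add: sum_\<delta>_snoc flip: sum_distrib_left)

text \<open>Up to \<open>q\<close> answers, a deceiver shows a constant drawn from
  \<open>\<mu>\<close>, and an honest location shows its true value, also drawn from
  \<open>\<mu>\<close>. Both likelihoods contain the same factor \<open>u\<close>, so the odds
  remain \<open>dprob\<close> against \<open>1 - \<kappa>\<close>. This is why fakes follow the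
  distribution of the values.\<close>

lemma \<delta>\<^sub>0_le_\<rho>:
  assumes r: "length r \<le> q" and k: "\<kappa> < 1"
  shows "\<delta>\<^sub>0 r \<le> \<rho> * \<beta>\<^sub>0 r"
proof -
  define u where "u = (\<Sum>f\<in>V. \<mu> f * of_bool (\<forall>y\<in>set r. y = f))"
  have "\<delta> x r = dprob * u" for x
    using r by (simp add: \<delta>_def dprob_def u_def sum_distrib_left mult_ac)
  then have "\<delta>\<^sub>0 r = dprob * u"
    by (simp add: \<delta>\<^sub>0_def sum_\<mu> flip: sum_distrib_right)
  also have "\<dots> = \<rho> * ((1 - \<kappa>) * u)" using k by (simp add: \<rho>_def)
  also have "(1 - \<kappa>) * u \<le> \<beta>\<^sub>0 r"
    unfolding u_def \<beta>\<^sub>0_def sum_distrib_left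
  proof (rule sum_mono)
    fix x assume x: "x \<in> V"
    have "(1 - \<kappa>) * of_bool (\<forall>y\<in>set r. y = x) \<le> \<beta> x r"
      unfolding \<beta>_def lik_honest[symmetric]
      using \<kappa> by (simp add: sum_nonneg \<mu>_nonneg lik_nonneg)
    then have "\<mu> x * ((1 - \<kappa>) * of_bool (\<forall>y\<in>set r. y = x)) \<le> \<mu> x * \<beta> x r"
      using \<mu>_nonneg[OF x] by (rule mult_left_mono)
    then show "(1 - \<kappa>) * (\<mu> x * of_bool (\<forall>y\<in>set r. y = x)) \<le> \<mu> x * \<beta> x r"
      by (simp add: mult_ac)
  qed
  finally show ?thesis using \<rho>_nonneg by (simp add: mult_left_mono)
qed

text \<open>
  Exponential tilting: under independent values, a late location is weighted by \<open>2\<close> if it is a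
  deceiver and normalised by \<open>1 + \<rho>\<close>.
\<close>

definition tilt :: "real list \<Rightarrow> real" where
  "tilt r = (if q < length r then (\<beta>\<^sub>0 r + \<delta>\<^sub>0 r) / (1 + \<rho>) else \<beta>\<^sub>0 r)"

lemma tilt_nonneg: "0 \<le> tilt r"
  using \<delta>\<^sub>0_nonneg[of r] \<delta>\<^sub>0_le_\<beta>\<^sub>0[of r] \<rho>_nonneg by (auto simp: tilt_def)

text \<open>Only the answer that makes a location late can lose weight: there
  \<open>\<delta>\<^sub>0_le_\<rho>\<close> shows that \<open>1 + \<rho>\<close> outweighs the
  factor 2 on the deceivers. All other steps preserve the sum.\<close>

lemma sum_tilt_snoc:
  assumes "\<kappa> < 1"
  shows "(\<Sum>y\<in>V. tilt (r @ [y])) \<le> tilt r"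
proof (cases "q \<le> length r")
  case True
  then have "(\<Sum>y\<in>V. tilt (r @ [y])) = (\<beta>\<^sub>0 r + \<delta>\<^sub>0 r) / (1 + \<rho>)"
    by (simp add: tilt_def sum_divide_distrib[symmetric] sum.distrib sum_\<beta>\<^sub>0_snoc sum_\<delta>\<^sub>0_snoc)
  moreover have "(\<beta>\<^sub>0 r + \<delta>\<^sub>0 r) / (1 + \<rho>) \<le> \<beta>\<^sub>0 r" if "length r = q"
    using \<delta>\<^sub>0_le_\<rho>[of r] that assms \<rho>_nonneg by (simp add: divide_le_eq algebra_simps)
  ultimately show ?thesis using True by (auto simp: tilt_def)
qed (simp add: tilt_def sum_\<beta>\<^sub>0_snoc)

text \<open>With independent values the sum factorises over the locations. At a late one the factor
  is \<open>2 * \<delta> + \<gamma> = \<beta> + \<delta>\<close>, whose mixture is the numerator of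
  \<open>tilt\<close>.\<close>

lemma sum_joint_tilt:
  "(\<Sum>ys | set ys \<subseteq> V \<and> length ys = n. (\<Prod>i<n. \<mu> (ys ! i)) *
      (\<Sum>G\<in>Pow {..<n}. joint G ys h * 2 ^ card (G \<inter> late h))) / (1 + \<rho>) ^ card (late h)
   = (\<Prod>i<n. tilt (resp i h))"
proof -
  let ?L = "late h"
  let ?s = "\<lambda>i. if i \<in> ?L then 1 + \<rho> else 1"
  have s: "(1 + \<rho>) ^ card ?L = (\<Prod>i<n. ?s i)"
    using late_subset[of h] by (simp add: prod.If_cases Int_absorb1)
  have G: "(\<Sum>G\<in>Pow {..<n}. joint G ys h * 2 ^ card (G \<inter> ?L)) =
      (\<Prod>i<n. \<delta> (ys ! i) (resp i h) * (if i \<in> ?L then 2 else 1) + \<gamma> (ys ! i) (resp i h))" for ys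
  proof -
    have "joint G ys h * 2 ^ card (G \<inter> ?L) = (\<Prod>i<n. if i \<in> G then \<delta> (ys ! i) (resp i h) * (if i \<in> ?L then 2 else 1)
        else \<gamma> (ys ! i) (resp i h))" if "G \<subseteq> {..<n}" for G
    proof -
      have two: "(2::real) ^ card (G \<inter> ?L) = (\<Prod>i<n. if i \<in> G \<inter> ?L then 2 else 1)"
        using that by (subst prod.If_cases) (auto intro!: arg_cong[where f = card])
      show ?thesis unfolding joint_def two prod.distrib[symmetric]
        by (intro prod.cong) auto
    qed
    then show ?thesis by (simp add: prod_add_Pow_if)
  qed
  have "(\<Sum>ys | set ys \<subseteq> V \<and> length ys = n. (\<Prod>i<n. \<mu> (ys ! i)) *
      (\<Sum>G\<in>Pow {..<n}. joint G ys h * 2 ^ card (G \<inter> ?L))) =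
     (\<Sum>ys | set ys \<subseteq> V \<and> length ys = n. \<Prod>i<n. \<mu> (ys ! i) *
        (\<delta> (ys ! i) (resp i h) * (if i \<in> ?L then 2 else 1) + \<gamma> (ys ! i) (resp i h)))"
    unfolding G prod.distrib[symmetric] ..
  also have "\<dots> = (\<Prod>i<n. \<Sum>x\<in>V. \<mu> x * (\<delta> x (resp i h) * (if i \<in> ?L then 2 else 1) + \<gamma> x (resp i h)))"
    by (rule sum_lists_prod[OF finite_V])
  also have "\<dots> = (\<Prod>i<n. tilt (resp i h) * ?s i)"
  proof (intro prod.cong refl)
    fix i assume i: "i \<in> {..<n}"
    have L: "i \<in> ?L \<longleftrightarrow> q < length (resp i h)" using i by (simp add: late_def)
    show "(\<Sum>x\<in>V. \<mu> x * (\<delta> x (resp i h) * (if i \<in> ?L then 2 else 1) + \<gamma> x (resp i h))) = tilt (resp i h) * ?s i"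
    proof (cases "q < length (resp i h)")
      case True
      have "(\<Sum>x\<in>V. \<mu> x * (\<delta> x (resp i h) * 2 + \<gamma> x (resp i h))) = \<beta>\<^sub>0 (resp i h) + \<delta>\<^sub>0 (resp i h)"
        unfolding \<beta>\<^sub>0_def \<delta>\<^sub>0_def \<gamma>_def sum.distrib[symmetric]
        by (intro sum.cong) (auto simp: algebra_simps)
      then show ?thesis using True \<rho>_nonneg L by (simp add: tilt_def)
    next
      case False
      then show ?thesis using L by (simp add: tilt_def \<gamma>_def \<beta>\<^sub>0_def)
    qed
  qed
  also have "\<dots> = (\<Prod>i<n. tilt (resp i h)) * (1 + \<rho>) ^ card ?L"
    by (simp add: s prod.distrib)
  finally show ?thesis using \<rho>_nonneg by simp
qed

lemma sum_joint_Nil: "(\<Sum>G\<in>Pow {..<n}. joint G ys []) = 1"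
  by (simp add: sum_joint)

end

context noise_instance
begin

text \<open>Probability of one particular ordering of \<open>xs\<close> under independent draws from
  \<open>\<mu>\<close>; it is the same for every member of \<open>perms\<close>.\<close>

definition type_prob :: real where "type_prob = (\<Prod>i<n. \<mu> (xs ! i))"

lemma prod_\<mu>_perms:
  assumes "ys \<in> perms" shows "(\<Prod>i<n. \<mu> (ys ! i)) = type_prob"
proof -
  have *: "(\<Prod>i<length zs. \<mu> (zs ! i)) = prod_mset (image_mset \<mu> (mset zs))" for zs
    by (simp add: prod_mset_prod_list prod.list_conv_set_nth atLeast0LessThan flip: mset_map)
  show ?thesis using *[of ys] *[of xs] assms length_xs perms_length[OF assms]
    by (simp add: type_prob_def perms_def)
qed

text \<open>An exponential Markov inequality with base 2 for the number of late deceivers. It is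
  proved in the independent model; restricting to the permutations of \<open>xs\<close> costs a
  division by \<open>type_prob\<close>.\<close>

lemma path_sum_many_late:
  assumes A: "algorithm_on n A" and k: "\<kappa> < 1" and type_prob: "0 < type_prob"
  shows "path_sum A V t (\<lambda>s. ennreal (\<Sum>ys\<in>perms. \<Sum>G\<in>Pow {..<n}. joint G ys (fst s) *
       of_bool (m0 < card (G \<inter> late (fst s)) \<and> card (late (fst s)) \<le> B)))
    \<le> ennreal ((1 + \<rho>) ^ B / (2 ^ m0 * type_prob))"
proof -
  define c where "c = (1 + \<rho>) ^ B / (2 ^ m0 * type_prob)"
  have c: "0 \<le> c" using \<rho>_nonneg type_prob by (simp add: c_def)
  let ?W = "\<lambda>h. ennreal (\<Prod>i<n. tilt (resp i h))"
  have pw: "(\<Sum>ys\<in>perms. \<Sum>G\<in>Pow {..<n}. joint G ys h * of_bool (m0 < card (G \<inter> late h) \<and> card (late h) \<le> B))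
     \<le> c * (\<Prod>i<n. tilt (resp i h))" for h
  proof -
    let ?L = "late h"
    let ?X = "\<lambda>ys. \<Sum>G\<in>Pow {..<n}. joint G ys h * 2 ^ card (G \<inter> ?L)"
    \<comment> \<open>On the event both quotients are at least 1: the Markov weight, and the
      normalisation for at most \<open>B\<close> late locations.\<close>
    have ob: "of_bool (m0 < card (G \<inter> ?L) \<and> card ?L \<le> B)
        \<le> 2 ^ card (G \<inter> ?L) / 2 ^ m0 * ((1 + \<rho>) ^ B / (1 + \<rho>) ^ card ?L)" for G
    proof (cases "m0 < card (G \<inter> ?L) \<and> card ?L \<le> B")
      case True
      have "1 \<le> (2::real) ^ card (G \<inter> ?L) / 2 ^ m0"
        using True by (simp add: le_divide_eq power_increasing)
      moreover have "1 \<le> (1 + \<rho>) ^ B / (1 + \<rho>) ^ card ?L"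
        using True \<rho>_nonneg by (simp add: le_divide_eq power_increasing)
      ultimately have "1 * 1 \<le> (2::real) ^ card (G \<inter> ?L) / 2 ^ m0 * ((1 + \<rho>) ^ B / (1 + \<rho>) ^ card ?L)"
        by (rule mult_mono) auto
      then show ?thesis using True by simp
    qed (use \<rho>_nonneg in auto)
    have "(\<Sum>ys\<in>perms. \<Sum>G\<in>Pow {..<n}. joint G ys h * of_bool (m0 < card (G \<inter> ?L) \<and> card ?L \<le> B)) \<le>
       (\<Sum>ys\<in>perms. \<Sum>G\<in>Pow {..<n}. joint G ys h * (2 ^ card (G \<inter> ?L) / 2 ^ m0 * ((1 + \<rho>) ^ B / (1 + \<rho>) ^ card ?L)))"
      by (intro sum_mono mult_left_mono ob joint_nonneg)
    also have "\<dots> = (\<Sum>ys\<in>perms. (1 + \<rho>) ^ B / (2 ^ m0 * type_prob) * ((\<Prod>i<n. \<mu> (ys ! i)) * ?X ys / (1 + \<rho>) ^ card ?L))"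
      using type_prob by (intro sum.cong refl) (simp add: prod_\<mu>_perms sum_distrib_left sum_divide_distrib mult_ac)
    also have "\<dots> = c * ((\<Sum>ys\<in>perms. (\<Prod>i<n. \<mu> (ys ! i)) * ?X ys) / (1 + \<rho>) ^ card ?L)"
      unfolding c_def sum_divide_distrib sum_distrib_left ..
    \<comment> \<open>Admitting all lists over \<open>V\<close> brings in the independent
      model.\<close>
    also have "\<dots> \<le> c * ((\<Sum>ys | set ys \<subseteq> V \<and> length ys = n. (\<Prod>i<n. \<mu> (ys ! i)) * ?X ys) / (1 + \<rho>) ^ card ?L)"
    proof (intro mult_left_mono c divide_right_mono sum_mono2)
      show "finite {ys. set ys \<subseteq> V \<and> length ys = n}" using finite_V by (rule finite_lists_length_eq)
      show "perms \<subseteq> {ys. set ys \<subseteq> V \<and> length ys = n}"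
        using set_xs perms_length by (auto simp: perms_def dest: mset_eq_setD)
      fix ys assume "ys \<in> {ys. set ys \<subseteq> V \<and> length ys = n} - perms"
      then have "0 \<le> \<mu> (ys ! i)" if "i < n" for i
        using that nth_mem[of i ys] by (intro \<mu>_nonneg) auto
      then show "0 \<le> (\<Prod>i<n. \<mu> (ys ! i)) * ?X ys"
        by (intro mult_nonneg_nonneg prod_nonneg sum_nonneg joint_nonneg) auto
    qed (use \<rho>_nonneg in auto)
    also have "\<dots> = c * (\<Prod>i<n. tilt (resp i h))"
      by (simp only: sum_joint_tilt)
    finally show ?thesis .
  qed
  have super: "(\<Sum>y\<in>V. ?W (h @ [(i, y)])) \<le> ?W h" if "i < n" for h i
    using sum_prod_resp_snoc_le[OF that, where V = V and \<phi> = "\<lambda>_. tilt" and h = h] sum_tilt_snoc[OF k] tilt_nonneg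
    by (subst sum_ennreal) (auto intro!: prod_nonneg ennreal_leI)
  have "path_sum A V t (\<lambda>s. ennreal (\<Sum>ys\<in>perms. \<Sum>G\<in>Pow {..<n}. joint G ys (fst s) *
       of_bool (m0 < card (G \<inter> late (fst s)) \<and> card (late (fst s)) \<le> B)))
     \<le> path_sum A V t (\<lambda>s. ennreal c * ?W (fst s))"
    using pw c tilt_nonneg
    by (intro path_sum_mono) (auto simp: ennreal_mult[symmetric] prod_nonneg intro!: ennreal_leI)
  also have "\<dots> = ennreal c * path_sum A V t (\<lambda>s. ?W (fst s))"
    by (rule path_sum_cmult)
  also have "\<dots> \<le> ennreal c * ?W []"
    by (intro mult_left_mono path_sum_supermartingale[OF A super]) auto
  also have "?W [] = 1"
    by (simp add: tilt_def \<beta>\<^sub>0_def sum_\<mu>)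
  finally show ?thesis by (simp add: c_def)
qed

end

section \<open>Prior distribution of the set of deceivers\<close>

context noise_model
begin

definition set_weight :: "nat set \<Rightarrow> real" where
  "set_weight G = (\<Prod>i<n. if i \<in> G then dprob else 1 - dprob)"

lemma set_weight_nonneg: "0 \<le> set_weight G"
  using dprob by (auto simp: set_weight_def intro!: prod_nonneg)

lemma joint_Nil_set_weight: "joint G ys [] = set_weight G"
  by (simp add: joint_Nil set_weight_def)

lemma sum_set_weight: "(\<Sum>G\<in>Pow {..<n}. set_weight G) = 1"
  using sum_joint_Nil by (simp add: joint_Nil_set_weight)

text \<open>In the expanded product a location of \<open>H\<close> retains only the summand
  \<open>1 - dprob\<close>, and any other location contributes 1.\<close>

lemma sum_set_weight_avoid:
  assumes "H \<subseteq> {..<n}"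
  shows "(\<Sum>G\<in>Pow {..<n}. set_weight G * of_bool (G \<inter> H = {})) = (1 - dprob) ^ card H"
proof -
  have "set_weight G * of_bool (G \<inter> H = {}) =
      (\<Prod>i<n. if i \<in> G then dprob * of_bool (i \<notin> H) else 1 - dprob)" if "G \<subseteq> {..<n}" for G
  proof (cases "G \<inter> H = {}")
    case True
    then show ?thesis by (auto simp: set_weight_def intro!: prod.cong)
  next
    case False
    then obtain i where "i \<in> G" "i \<in> H" "i < n" using assms by (auto simp: subset_eq)
    then have "(\<Prod>i<n. if i \<in> G then dprob * of_bool (i \<notin> H) else 1 - dprob) = 0"
      by (intro prod_zero) auto
    then show ?thesis using False by simp
  qed
  then have "(\<Sum>G\<in>Pow {..<n}. set_weight G * of_bool (G \<inter> H = {})) = (\<Prod>i<n. dprob * of_bool (i \<notin> H) + (1 - dprob))"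
    by (simp add: prod_add_Pow_if)
  also have "\<dots> = (\<Prod>i<n. if i \<in> H then 1 - dprob else 1)"
    by (intro prod.cong) auto
  also have "\<dots> = (1 - dprob) ^ card H"
    using assms by (simp add: prod.If_cases Int_absorb1)
  finally show ?thesis .
qed

text \<open>A Chernoff bound with weight \<open>2 ^ g0 * (1/2) ^ card G\<close>; each location
  contributes \<open>dprob / 2 + (1 - dprob)\<close> to its mean.\<close>

lemma sum_set_weight_small:
  "(\<Sum>G\<in>Pow {..<n}. set_weight G * of_bool (card G < g0)) \<le> 2 ^ g0 * (1 - dprob / 2) ^ n"
proof -
  have half: "set_weight G * (1/2) ^ card G = (\<Prod>i<n. if i \<in> G then dprob / 2 else 1 - dprob)" if "G \<subseteq> {..<n}" for G
  proof -
    have two: "(1/2 :: real) ^ card G = (\<Prod>i<n. if i \<in> G then 1/2 else 1)"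
      using that by (simp add: prod.If_cases Int_absorb1)
    show ?thesis unfolding set_weight_def two prod.distrib[symmetric] by (intro prod.cong) auto
  qed
  have "(\<Sum>G\<in>Pow {..<n}. set_weight G * of_bool (card G < g0)) \<le> (\<Sum>G\<in>Pow {..<n}. set_weight G * (2 ^ g0 * (1/2) ^ card G))"
  proof (intro sum_mono mult_left_mono set_weight_nonneg)
    fix G :: "nat set"
    have "1 \<le> (2::real) ^ (g0 - card G)" by simp
    also have "\<dots> = 2 ^ g0 * (1/2) ^ card G" if "card G < g0"
      using that by (simp add: power_diff power_one_over)
    finally show "of_bool (card G < g0) \<le> (2::real) ^ g0 * (1/2) ^ card G" by auto
  qed
  also have "\<dots> = 2 ^ g0 * (\<Sum>G\<in>Pow {..<n}. set_weight G * (1/2) ^ card G)"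
    by (simp add: sum_distrib_left mult_ac)
  also have "(\<Sum>G\<in>Pow {..<n}. set_weight G * (1/2) ^ card G) = (\<Prod>i<n. dprob / 2 + (1 - dprob))"
    by (subst prod_add_Pow_if) (auto simp: half intro!: sum.cong)
  also have "\<dots> = (1 - dprob / 2) ^ n" by simp
  finally show ?thesis .
qed

end

section \<open>Combining the estimates against one algorithm\<close>

context noise_instance
begin

text \<open>Summing \<open>joint\<close> over the answers returns it, so an event fixed by the
  values and the deceivers never exceeds its prior weight, whatever is queried.\<close>

lemma path_sum_static:
  assumes A: "algorithm_on n A" and c: "\<And>ys G. 0 \<le> c ys G"
  shows "path_sum A V t (\<lambda>s. ennreal (\<Sum>ys\<in>perms. \<Sum>G\<in>Pow {..<n}. joint G ys (fst s) * c ys G))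
    \<le> ennreal (\<Sum>ys\<in>perms. \<Sum>G\<in>Pow {..<n}. set_weight G * c ys G)"
proof -
  let ?W = "\<lambda>h. ennreal (\<Sum>ys\<in>perms. \<Sum>G\<in>Pow {..<n}. joint G ys h * c ys G)"
  have "(\<Sum>y\<in>V. ?W (h @ [(i, y)])) \<le> ?W h" if i: "i < n" for h i
  proof -
    have "(\<Sum>y\<in>V. \<Sum>ys\<in>perms. \<Sum>G\<in>Pow {..<n}. joint G ys (h @ [(i, y)]) * c ys G) =
        (\<Sum>ys\<in>perms. \<Sum>G\<in>Pow {..<n}. \<Sum>y\<in>V. joint G ys (h @ [(i, y)]) * c ys G)"
      by (subst sum.swap, subst sum.swap) (rule refl)
    also have "\<dots> = (\<Sum>ys\<in>perms. \<Sum>G\<in>Pow {..<n}. joint G ys h * c ys G)"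
      by (intro sum.cong refl) (simp add: sum_joint_snoc i perms_nth flip: sum_distrib_right)
    finally show ?thesis
      by (subst sum_ennreal) (auto intro!: sum_nonneg mult_nonneg_nonneg joint_nonneg c)
  qed
  then have "path_sum A V t (\<lambda>s. ?W (fst s)) \<le> ?W []"
    by (rule path_sum_supermartingale[OF A])
  then show ?thesis by (simp add: joint_Nil_set_weight)
qed

lemma card_threshold_set_perms:
  assumes "ys \<in> perms" shows "card (threshold_set v ys) = num_ge v xs"
proof -
  have *: "card (threshold_set v zs) = size (filter_mset (\<lambda>x. v \<le> x) (mset zs))" for zs
    by (simp add: threshold_set_def length_filter_conv_card flip: mset_filter)
  show ?thesis using *[of ys] *[of xs] assms by (simp add: perms_def num_ge_def)
qed

lemma sum_perms_no_high:
  "(\<Sum>ys\<in>perms. \<Sum>G\<in>Pow {..<n}. set_weight G * of_bool (\<not> (\<exists>i\<in>G. v \<le> ys ! i))) =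
   real (card perms) * (1 - dprob) ^ num_ge v xs"
proof -
  have "(\<Sum>G\<in>Pow {..<n}. set_weight G * of_bool (\<not> (\<exists>i\<in>G. v \<le> ys ! i))) = (1 - dprob) ^ num_ge v xs"
    if ys: "ys \<in> perms" for ys
  proof -
    have "(\<Sum>G\<in>Pow {..<n}. set_weight G * of_bool (\<not> (\<exists>i\<in>G. v \<le> ys ! i))) =
        (\<Sum>G\<in>Pow {..<n}. set_weight G * of_bool (G \<inter> threshold_set v ys = {}))"
      by (intro sum.cong refl arg_cong2[where f = "(*)"] arg_cong[where f = of_bool])
         (auto simp: threshold_set_def perms_length[OF ys])
    then show ?thesis using sum_set_weight_avoid[of "threshold_set v ys"] card_threshold_set_perms[OF ys]
      by (auto simp: threshold_set_def perms_length[OF ys] subset_eq)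
  qed
  then show ?thesis by simp
qed

lemma sum_perms_no_low:
  "(\<Sum>ys\<in>perms. \<Sum>G\<in>Pow {..<n}. set_weight G * of_bool (\<not> (\<exists>i\<in>G. \<not> v \<le> ys ! i))) =
   real (card perms) * (1 - dprob) ^ (n - num_ge v xs)"
proof -
  have "(\<Sum>G\<in>Pow {..<n}. set_weight G * of_bool (\<not> (\<exists>i\<in>G. \<not> v \<le> ys ! i))) = (1 - dprob) ^ (n - num_ge v xs)"
    if ys: "ys \<in> perms" for ys
  proof -
    let ?H = "{..<n} - threshold_set v ys"
    have "(\<Sum>G\<in>Pow {..<n}. set_weight G * of_bool (\<not> (\<exists>i\<in>G. \<not> v \<le> ys ! i))) =
        (\<Sum>G\<in>Pow {..<n}. set_weight G * of_bool (G \<inter> ?H = {}))"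
      by (intro sum.cong refl arg_cong2[where f = "(*)"] arg_cong[where f = of_bool])
         (auto simp: threshold_set_def perms_length[OF ys])
    moreover have "card ?H = n - num_ge v xs"
      using card_Diff_subset[of "threshold_set v ys" "{..<n}"] card_threshold_set_perms[OF ys]
      by (auto simp: threshold_set_def perms_length[OF ys] subset_eq)
    ultimately show ?thesis using sum_set_weight_avoid[of ?H] by simp
  qed
  then show ?thesis by simp
qed

text \<open>The fake weights add up to 1, so a bound against each fake adversary passes to their
  average. The permutations are summed without normalisation, hence the factor
  \<open>card perms\<close>.\<close>

lemma path_sum_total:
  assumes A: "algorithm_on n A" and \<phi>: "\<And>ys c. ys \<in> perms \<Longrightarrow> c \<in> fakes \<Longrightarrow>
      (\<integral>\<^sup>+ s. \<phi> s \<partial>measure_pmf (run A (fake_adv ys c) ys t)) \<le> ennreal T" and T: "0 \<le> T"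
  shows "path_sum A V t (\<lambda>s. ennreal (\<Sum>ys\<in>perms. \<Sum>G\<in>Pow {..<n}. joint G ys (fst s)) * \<phi> s)
     \<le> ennreal (real (card perms) * T)"
proof -
  have "path_sum A V t (\<lambda>s. ennreal (\<Sum>ys\<in>perms. \<Sum>G\<in>Pow {..<n}. joint G ys (fst s)) * \<phi> s) =
      path_sum A V t (\<lambda>s. \<Sum>ys\<in>perms. ennreal (\<Sum>G\<in>Pow {..<n}. joint G ys (fst s)) * \<phi> s)"
    by (intro arg_cong[where f = "path_sum A V t"] ext)
       (simp add: sum_distrib_right[symmetric] sum_nonneg joint_nonneg)
  also have "\<dots> = (\<Sum>ys\<in>perms. \<Sum>c\<in>fakes. ennreal (fake_weight c) *
      (\<integral>\<^sup>+ s. \<phi> s \<partial>measure_pmf (run A (fake_adv ys c) ys t)))"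
    by (simp add: path_sum_sum finite_perms sum_nn_integral_run[OF A] perms_nth)
  also have "\<dots> \<le> (\<Sum>ys\<in>perms. \<Sum>c\<in>fakes. ennreal (fake_weight c) * ennreal T)"
    by (intro sum_mono mult_left_mono \<phi>) auto
  also have "\<dots> = (\<Sum>ys\<in>perms. ennreal T)"
    by (simp add: sum_distrib_right[symmetric] fake_weight_nonneg sum_fake_weight)
  also have "\<dots> = ennreal (real (card perms) * T)"
    using T by (simp add: ennreal_mult ennreal_of_nat_eq_real_of_nat)
  finally show ?thesis .
qed

lemma path_sum_correct:
  assumes A: "algorithm_on n A" and p: "0 \<le> p"
    and \<phi>: "\<And>ys c. ys \<in> perms \<Longrightarrow> c \<in> fakes \<Longrightarrow>
      p \<le> measure_pmf.prob (run A (fake_adv ys c) ys t) {(h, out). out = Some (threshold_set v ys)}"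
  shows "ennreal (real (card perms) * p) \<le>
    path_sum A V t (\<lambda>s. ennreal (\<Sum>ys\<in>perms. \<Sum>G\<in>Pow {..<n}. joint G ys (fst s) * of_bool (snd s = Some (threshold_set v ys))))"
proof -
  have "ennreal (real (card perms) * p) = (\<Sum>ys\<in>perms. \<Sum>c\<in>fakes. ennreal (fake_weight c) * ennreal p)"
    using p by (simp add: sum_distrib_right[symmetric] fake_weight_nonneg sum_fake_weight
        ennreal_mult ennreal_of_nat_eq_real_of_nat)
  also have "\<dots> \<le> (\<Sum>ys\<in>perms. \<Sum>c\<in>fakes. ennreal (fake_weight c) *
      (\<integral>\<^sup>+ s. of_bool (snd s = Some (threshold_set v ys)) \<partial>measure_pmf (run A (fake_adv ys c) ys t)))"
  proof (intro sum_mono mult_left_mono)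
    fix ys c assume *: "ys \<in> perms" "c \<in> fakes"
    let ?M = "run A (fake_adv ys c) ys t" and ?E = "{(h :: history, out). out = Some (threshold_set v ys)}"
    have "(\<integral>\<^sup>+ s. of_bool (snd s = Some (threshold_set v ys)) \<partial>measure_pmf ?M) = (\<integral>\<^sup>+ s. indicator ?E s \<partial>measure_pmf ?M)"
      by (intro nn_integral_cong) (auto simp: indicator_def)
    also have "\<dots> = ennreal (measure_pmf.prob ?M ?E)"
      by (simp add: measure_pmf.emeasure_eq_measure)
    finally show "ennreal p \<le> (\<integral>\<^sup>+ s. of_bool (snd s = Some (threshold_set v ys)) \<partial>measure_pmf ?M)"
      using \<phi>[OF *] by (simp add: ennreal_leI)
  qed simp
  also have "\<dots> = path_sum A V t (\<lambda>s. \<Sum>ys\<in>perms. ennreal (\<Sum>G\<in>Pow {..<n}. joint G ys (fst s)) * of_bool (snd s = Some (threshold_set v ys)))"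
    unfolding path_sum_sum[OF finite_perms]
    by (intro sum.cong refl sum_nn_integral_run[OF A]) (auto simp: perms_nth)
  also have "\<dots> = path_sum A V t (\<lambda>s. ennreal (\<Sum>ys\<in>perms. \<Sum>G\<in>Pow {..<n}. joint G ys (fst s) * of_bool (snd s = Some (threshold_set v ys))))"
  proof (intro arg_cong[where f = "path_sum A V t"] ext)
    fix s :: "history \<times> nat set option"
    have "(\<Sum>ys\<in>perms. ennreal (\<Sum>G\<in>Pow {..<n}. joint G ys (fst s)) * of_bool (snd s = Some (threshold_set v ys))) =
       (\<Sum>ys\<in>perms. ennreal (\<Sum>G\<in>Pow {..<n}. joint G ys (fst s) * of_bool (snd s = Some (threshold_set v ys))))"
      by (intro sum.cong) auto
    also have "\<dots> = ennreal (\<Sum>ys\<in>perms. \<Sum>G\<in>Pow {..<n}. joint G ys (fst s) * of_bool (snd s = Some (threshold_set v ys)))"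
      by (rule sum_ennreal) (auto intro!: sum_nonneg joint_nonneg)
    finally show "(\<Sum>ys\<in>perms. ennreal (\<Sum>G\<in>Pow {..<n}. joint G ys (fst s)) * of_bool (snd s = Some (threshold_set v ys))) = \<dots>" .
  qed
  finally show ?thesis .
qed

text \<open>\<open>path_sum_all_late\<close> is applied to each \<open>G\<close> separately; its
  bound is worst at \<open>card G = g0\<close>, and the prior weights of the sets involved sum to at
  most 1.\<close>

lemma path_sum_all_late_total:
  assumes A: "algorithm_on n A" and m0: "m0 < g0"
  shows "path_sum A V t (\<lambda>s. ennreal (\<Sum>ys\<in>perms. \<Sum>G\<in>Pow {..<n}. joint G ys (fst s) *
       of_bool (g0 \<le> card G \<and> card (G \<inter> late (fst s)) \<le> m0 \<and> (\<exists>i\<in>G. P (ys ! i)) \<and>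
         (\<forall>i\<in>G. P (ys ! i) \<longrightarrow> i \<in> late (fst s)))))
    \<le> ennreal (real (card perms) * (real m0 / (real g0 - real m0)))"
proof -
  let ?E = "\<lambda>G ys h. card (G \<inter> late h) \<le> m0 \<and> (\<exists>i\<in>G. P (ys ! i)) \<and> (\<forall>i\<in>G. P (ys ! i) \<longrightarrow> i \<in> late h)"
  let ?F = "{G \<in> Pow {..<n}. g0 \<le> card G}"
  have fin: "finite ?F" by simp
  have "path_sum A V t (\<lambda>s. ennreal (\<Sum>ys\<in>perms. \<Sum>G\<in>Pow {..<n}. joint G ys (fst s) * of_bool (g0 \<le> card G \<and> ?E G ys (fst s)))) =
     path_sum A V t (\<lambda>s. \<Sum>G\<in>?F. ennreal (\<Sum>ys\<in>perms. joint G ys (fst s) * of_bool (?E G ys (fst s))))"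
  proof (intro arg_cong[where f = "path_sum A V t"] ext)
    fix s :: "history \<times> nat set option"
    have "(\<Sum>ys\<in>perms. \<Sum>G\<in>Pow {..<n}. joint G ys (fst s) * of_bool (g0 \<le> card G \<and> ?E G ys (fst s))) =
      (\<Sum>G\<in>Pow {..<n}. if g0 \<le> card G then \<Sum>ys\<in>perms. joint G ys (fst s) * of_bool (?E G ys (fst s)) else 0)"
      by (subst sum.swap, intro sum.cong) auto
    also have "\<dots> = (\<Sum>G\<in>?F. \<Sum>ys\<in>perms. joint G ys (fst s) * of_bool (?E G ys (fst s)))"
      by (subst sum.inter_filter) auto
    finally show "ennreal (\<Sum>ys\<in>perms. \<Sum>G\<in>Pow {..<n}. joint G ys (fst s) * of_bool (g0 \<le> card G \<and> ?E G ys (fst s))) =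
      (\<Sum>G\<in>?F. ennreal (\<Sum>ys\<in>perms. joint G ys (fst s) * of_bool (?E G ys (fst s))))"
      by (subst sum_ennreal) (auto intro!: sum_nonneg joint_nonneg)
  qed
  also have "\<dots> = (\<Sum>G\<in>?F. path_sum A V t (\<lambda>s. ennreal (\<Sum>ys\<in>perms. joint G ys (fst s) * of_bool (?E G ys (fst s)))))"
    by (rule path_sum_sum[OF fin])
  also have "\<dots> \<le> (\<Sum>G\<in>?F. ennreal (real m0 / (real (card G) - real m0) * (\<Sum>ys\<in>perms. joint G ys [])))"
    using m0 by (intro sum_mono path_sum_all_late[OF A]) auto
  also have "\<dots> \<le> (\<Sum>G\<in>?F. ennreal (real m0 / (real g0 - real m0) * (real (card perms) * set_weight G)))"
    using m0 by (intro sum_mono ennreal_leI mult_mono frac_le) (auto simp: joint_Nil_set_weight set_weight_nonneg)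
  also have "\<dots> = ennreal (\<Sum>G\<in>?F. real m0 / (real g0 - real m0) * (real (card perms) * set_weight G))"
    using m0 by (intro sum_ennreal) (auto simp: set_weight_nonneg)
  also have "\<dots> \<le> ennreal (real (card perms) * (real m0 / (real g0 - real m0)))"
  proof (rule ennreal_leI)
    have "(\<Sum>G\<in>?F. set_weight G) \<le> 1"
      using sum_mono2[of "Pow {..<n}" ?F set_weight] set_weight_nonneg sum_set_weight by auto
    then have "real m0 / (real g0 - real m0) * real (card perms) * (\<Sum>G\<in>?F. set_weight G)
        \<le> real m0 / (real g0 - real m0) * real (card perms) * 1"
      using m0 by (intro mult_left_mono) auto
    then show "(\<Sum>G\<in>?F. real m0 / (real g0 - real m0) * (real (card perms) * set_weight G))
        \<le> real (card perms) * (real m0 / (real g0 - real m0))"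
      by (simp add: sum_distrib_left mult_ac)
  qed
  finally show ?thesis .
qed

text \<open>By \<open>sum_joint_correct_le\<close>, twice the success probability is at most 1 plus
  the probability that no swap is available, and \<open>2 * 33/50 - 1 = 8/25\<close>. The right side
  is a union bound over the ways in which a swap can be missing.\<close>

theorem error_bound:
  fixes v T \<kappa>1 \<kappa>2 :: real and B m0 g0 :: nat
  defines "k \<equiv> num_ge v xs"
  assumes A: "algorithm_on n A" and m0: "m0 < g0" and T: "0 \<le> T"
    and correct: "\<And>ys c. ys \<in> perms \<Longrightarrow> c \<in> fakes \<Longrightarrow>
      33/50 \<le> measure_pmf.prob (run A (fake_adv ys c) ys t) {(h, out). out = Some (threshold_set v ys)}"
    and cost: "\<And>ys c. ys \<in> perms \<Longrightarrow> c \<in> fakes \<Longrightarrow>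
      (\<integral>\<^sup>+ s. of_nat (length (fst s)) \<partial>measure_pmf (run A (fake_adv ys c) ys t)) \<le> ennreal T"
    and small: "(\<Sum>G\<in>Pow {..<n}. set_weight G * of_bool (card G < g0)) \<le> \<kappa>1"
    and many: "path_sum A V t (\<lambda>s. ennreal (\<Sum>ys\<in>perms. \<Sum>G\<in>Pow {..<n}. joint G ys (fst s) *
       of_bool (m0 < card (G \<inter> late (fst s)) \<and> card (late (fst s)) \<le> B)))
      \<le> ennreal (real (card perms) * \<kappa>2)" and \<kappa>2: "0 \<le> \<kappa>2"
  shows "8/25 \<le> (1 - dprob) ^ k + (1 - dprob) ^ (n - k) + \<kappa>1 + \<kappa>2
    + T / (real (q + 1) * real (B + 1)) + 2 * (real m0 / (real g0 - real m0))"
proof -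
  \<comment> \<open>Weights are summed, not averaged, over the permutations, so every term carries
    \<open>K\<close> until it is cancelled at the end.\<close>
  define K where "K = real (card perms)"
  have "xs \<in> perms" by (simp add: perms_def)
  then have K: "0 < K" using finite_perms by (auto simp: K_def card_gt_0_iff)
  let ?I = "\<lambda>s f. \<Sum>ys\<in>perms. \<Sum>G\<in>Pow {..<n}. joint G ys (fst s) * of_bool (f ys G (fst s))"
  define E1 where "E1 = (\<lambda>ys G (h::history). \<not> (\<exists>i\<in>G. v \<le> (ys :: real list) ! i))"
  define E2 where "E2 = (\<lambda>ys G (h::history). \<not> (\<exists>i\<in>G. \<not> v \<le> (ys :: real list) ! i))"
  define E3 where "E3 = (\<lambda>(ys :: real list) (G :: nat set) (h::history). card G < g0)"
  define E4 where "E4 = (\<lambda>(ys :: real list) G h. m0 < card (G \<inter> late h) \<and> card (late h) \<le> B)"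
  define E5 where "E5 = (\<lambda>(ys :: real list) (G :: nat set) h. B < card (late h))"
  define E where "E = (\<lambda>P (ys :: real list) G h. g0 \<le> card G \<and> card (G \<inter> late h) \<le> m0 \<and>
      (\<exists>i\<in>G. P (ys ! i)) \<and> (\<forall>i\<in>G. P (ys ! i) \<longrightarrow> i \<in> late h))"
  let ?P = "\<lambda>x. v \<le> x" and ?P' = "\<lambda>x. \<not> v \<le> x"
  let ?path = "path_sum A V t"
  define b where "b = (\<lambda>(ys :: real list) G h. (\<exists>i\<in>G - late h. v \<le> ys ! i) \<and> (\<exists>j\<in>G - late h. \<not> v \<le> ys ! j))"
  have I0: "0 \<le> ?I s f" for s f by (intro sum_nonneg mult_nonneg_nonneg joint_nonneg) auto
  have pointwise: "2 * (\<Sum>ys\<in>perms. \<Sum>G\<in>Pow {..<n}. joint G ys (fst s) * of_bool (snd s = Some (threshold_set v ys)))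
      \<le> (\<Sum>ys\<in>perms. \<Sum>G\<in>Pow {..<n}. joint G ys (fst s) * 1)
        + (?I s E1 + (?I s E2 + (?I s E3 + (?I s E4 + (?I s E5 + (?I s (E ?P) + ?I s (E ?P')))))))" for s
  proof -
    let ?h = "fst s"
    have "2 * (\<Sum>ys\<in>perms. joint G ys ?h * of_bool (snd s = Some (threshold_set v ys)))
        \<le> (\<Sum>ys\<in>perms. joint G ys ?h) + (\<Sum>ys\<in>perms. joint G ys ?h * of_bool (\<not> b ys G ?h))" if G: "G \<in> Pow {..<n}" for G
    proof (cases "snd s")
      case None
      then show ?thesis by (auto intro!: add_nonneg_nonneg sum_nonneg joint_nonneg mult_nonneg_nonneg)
    next
      case (Some S)
      then show ?thesis using sum_joint_correct_le[of G ?h S v] G by (simp add: b_def)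
    qed
    then have "(\<Sum>G\<in>Pow {..<n}. 2 * (\<Sum>ys\<in>perms. joint G ys ?h * of_bool (snd s = Some (threshold_set v ys))))
        \<le> (\<Sum>G\<in>Pow {..<n}. (\<Sum>ys\<in>perms. joint G ys ?h) + (\<Sum>ys\<in>perms. joint G ys ?h * of_bool (\<not> b ys G ?h)))"
      by (rule sum_mono)
    also have "\<dots> = (\<Sum>G\<in>Pow {..<n}. \<Sum>ys\<in>perms. joint G ys ?h) + (\<Sum>G\<in>Pow {..<n}. \<Sum>ys\<in>perms. joint G ys ?h * of_bool (\<not> b ys G ?h))"
      by (rule sum.distrib)
    finally have 1: "2 * (\<Sum>ys\<in>perms. \<Sum>G\<in>Pow {..<n}. joint G ys ?h * of_bool (snd s = Some (threshold_set v ys)))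
        \<le> (\<Sum>ys\<in>perms. \<Sum>G\<in>Pow {..<n}. joint G ys ?h * 1) + ?I s (\<lambda>ys G h. \<not> b ys G h)"
      by (simp add: sum_distrib_left[symmetric] sum.swap[of _ perms "Pow {..<n}"])
    have "?I s (\<lambda>ys G h. \<not> b ys G h) \<le>
        (\<Sum>ys\<in>perms. \<Sum>G\<in>Pow {..<n}. joint G ys ?h * (of_bool (E1 ys G ?h) + (of_bool (E2 ys G ?h) + (of_bool (E3 ys G ?h)
          + (of_bool (E4 ys G ?h) + (of_bool (E5 ys G ?h) + (of_bool (E ?P ys G ?h) + of_bool (E ?P' ys G ?h))))))))"
    proof (intro sum_mono mult_left_mono joint_nonneg)
      fix ys G
      \<comment> \<open>Without a swap, \<open>G - late h\<close> lacks high or low values: either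
        \<open>G\<close> itself lacks them, or those it has are all late. \<open>E3\<close>,
        \<open>E4\<close> and \<open>E5\<close> absorb the cases in which \<open>E\<close> has no
        estimate.\<close>
      have "\<not> b ys G ?h \<longrightarrow> E1 ys G ?h \<or> E2 ys G ?h \<or> E3 ys G ?h \<or> E4 ys G ?h \<or> E5 ys G ?h \<or> E ?P ys G ?h \<or> E ?P' ys G ?h"
        unfolding b_def E1_def E2_def E3_def E4_def E5_def E_def
        using le_less_linear[of g0 "card G"] le_less_linear[of "card (G \<inter> late ?h)" m0]
          le_less_linear[of "card (late ?h)" B] by blast
      then show "of_bool (\<not> b ys G ?h) \<le> of_bool (E1 ys G ?h) + (of_bool (E2 ys G ?h) + (of_bool (E3 ys G ?h)
          + (of_bool (E4 ys G ?h) + (of_bool (E5 ys G ?h) + (of_bool (E ?P ys G ?h) + (of_bool (E ?P' ys G ?h) :: real))))))"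
        by (auto simp: of_bool_def)
    qed
    then show ?thesis using 1 by (simp add: distrib_left sum.distrib)
  qed
  have b0: "?path (\<lambda>s. ennreal (\<Sum>ys\<in>perms. \<Sum>G\<in>Pow {..<n}. joint G ys (fst s) * 1)) \<le> ennreal K"
    using path_sum_static[OF A, of "\<lambda>_ _. 1" t] by (simp add: sum_set_weight K_def)
  have b1: "?path (\<lambda>s. ennreal (?I s E1)) \<le> ennreal (K * (1 - dprob) ^ k)"
    using path_sum_static[OF A, of "\<lambda>ys G. of_bool (E1 ys G [])" t] sum_perms_no_high[of v]
    by (simp add: E1_def K_def k_def)
  have b2: "?path (\<lambda>s. ennreal (?I s E2)) \<le> ennreal (K * (1 - dprob) ^ (n - k))"
    using path_sum_static[OF A, of "\<lambda>ys G. of_bool (E2 ys G [])" t] sum_perms_no_low[of v]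
    by (simp add: E2_def K_def k_def)
  have "?path (\<lambda>s. ennreal (?I s E3)) \<le> ennreal (K * (\<Sum>G\<in>Pow {..<n}. set_weight G * of_bool (card G < g0)))"
    using path_sum_static[OF A, of "\<lambda>ys G. of_bool (E3 ys G [])" t]
    by (simp add: E3_def K_def)
  also have "\<dots> \<le> ennreal (K * \<kappa>1)"
    using small K by (intro ennreal_leI mult_left_mono) auto
  finally have b3: "?path (\<lambda>s. ennreal (?I s E3)) \<le> ennreal (K * \<kappa>1)" .
  have b4: "?path (\<lambda>s. ennreal (?I s E4)) \<le> ennreal (K * \<kappa>2)"
    using many by (simp add: E4_def K_def)
  \<comment> \<open>The Markov constant: more than \<open>B\<close> late locations cost at least
    \<open>(q + 1) * (B + 1)\<close> queries.\<close>
  define r where "r = 1 / (real (q + 1) * real (B + 1))"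
  have "?path (\<lambda>s. ennreal (?I s E5)) \<le>
      ?path (\<lambda>s. ennreal r * (ennreal (\<Sum>ys\<in>perms. \<Sum>G\<in>Pow {..<n}. joint G ys (fst s)) * of_nat (length (fst s))))"
  proof (rule path_sum_mono)
    fix s :: "history \<times> nat set option"
    have len: "of_bool (B < card (late (fst s))) \<le> r * real (length (fst s))"
    proof (cases "B < card (late (fst s))")
      case True
      then have "(q + 1) * (B + 1) \<le> (q + 1) * card (late (fst s))" by (intro mult_left_mono) auto
      also have "\<dots> \<le> length (fst s)" by (rule card_late_le)
      finally have "real ((q + 1) * (B + 1)) \<le> real (length (fst s))" by (rule of_nat_mono)
      then show ?thesis using True unfolding r_def of_nat_mult by (simp add: pos_le_divide_eq del: of_nat_Suc of_nat_add)
    qed (simp add: r_def)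
    have "?I s E5 \<le> (\<Sum>ys\<in>perms. \<Sum>G\<in>Pow {..<n}. joint G ys (fst s) * (r * real (length (fst s))))"
      unfolding E5_def by (intro sum_mono mult_left_mono joint_nonneg len)
    also have "\<dots> = r * ((\<Sum>ys\<in>perms. \<Sum>G\<in>Pow {..<n}. joint G ys (fst s)) * real (length (fst s)))"
      by (simp add: sum_distrib_left sum_distrib_right mult_ac)
    finally have le: "ennreal (?I s E5) \<le> ennreal (r * ((\<Sum>ys\<in>perms. \<Sum>G\<in>Pow {..<n}. joint G ys (fst s)) * real (length (fst s))))"
      by (rule ennreal_leI)
    show "ennreal (?I s E5) \<le> ennreal r * (ennreal (\<Sum>ys\<in>perms. \<Sum>G\<in>Pow {..<n}. joint G ys (fst s)) * of_nat (length (fst s)))"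
    proof -
      have "0 \<le> r" "0 \<le> (\<Sum>ys\<in>perms. \<Sum>G\<in>Pow {..<n}. joint G ys (fst s))"
        by (auto simp: r_def intro!: sum_nonneg joint_nonneg)
      then have "ennreal (r * ((\<Sum>ys\<in>perms. \<Sum>G\<in>Pow {..<n}. joint G ys (fst s)) * real (length (fst s)))) =
          ennreal r * (ennreal (\<Sum>ys\<in>perms. \<Sum>G\<in>Pow {..<n}. joint G ys (fst s)) * of_nat (length (fst s)))"
        by (simp add: ennreal_mult ennreal_of_nat_eq_real_of_nat)
      then show ?thesis using le by (simp only:)
    qed
  qed
  also have "\<dots> = ennreal r * ?path (\<lambda>s. ennreal (\<Sum>ys\<in>perms. \<Sum>G\<in>Pow {..<n}. joint G ys (fst s)) * of_nat (length (fst s)))"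
    by (rule path_sum_cmult)
  also have "\<dots> \<le> ennreal r * ennreal (K * T)"
    unfolding K_def by (intro mult_left_mono path_sum_total[OF A cost T]) auto
  also have "\<dots> = ennreal (K * (r * T))"
    using K T by (simp add: r_def ennreal_mult[symmetric] mult_ac)
  finally have b5: "?path (\<lambda>s. ennreal (?I s E5)) \<le> ennreal (K * (r * T))" .
  have b6: "?path (\<lambda>s. ennreal (?I s (E P))) \<le> ennreal (K * (real m0 / (real g0 - real m0)))" for P
    unfolding E_def K_def by (rule path_sum_all_late_total[OF A m0])
  have nn: "0 \<le> \<kappa>1"
    using small order_trans[OF sum_nonneg small] set_weight_nonneg by auto
  let ?x = "real m0 / (real g0 - real m0)"
  have "ennreal (2 * (K * (33/50))) = 2 * ennreal (K * (33/50))"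
    using K by (subst ennreal_mult) auto
  also have "\<dots> \<le> 2 * ?path (\<lambda>s. ennreal (\<Sum>ys\<in>perms. \<Sum>G\<in>Pow {..<n}. joint G ys (fst s) * of_bool (snd s = Some (threshold_set v ys))))"
    unfolding K_def by (intro mult_left_mono path_sum_correct[OF A _ correct]) auto
  also have "\<dots> = ?path (\<lambda>s. 2 * ennreal (\<Sum>ys\<in>perms. \<Sum>G\<in>Pow {..<n}. joint G ys (fst s) * of_bool (snd s = Some (threshold_set v ys))))"
    by (rule path_sum_cmult[symmetric])
  also have "\<dots> \<le> ?path (\<lambda>s. ennreal (\<Sum>ys\<in>perms. \<Sum>G\<in>Pow {..<n}. joint G ys (fst s) * 1) + (ennreal (?I s E1)
      + (ennreal (?I s E2) + (ennreal (?I s E3) + (ennreal (?I s E4) + (ennreal (?I s E5) + (ennreal (?I s (E ?P)) + ennreal (?I s (E ?P')))))))))"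
  proof (rule path_sum_mono)
    fix s :: "history \<times> nat set option"
    have "2 * ennreal (\<Sum>ys\<in>perms. \<Sum>G\<in>Pow {..<n}. joint G ys (fst s) * of_bool (snd s = Some (threshold_set v ys))) =
      ennreal (2 * (\<Sum>ys\<in>perms. \<Sum>G\<in>Pow {..<n}. joint G ys (fst s) * of_bool (snd s = Some (threshold_set v ys))))"
      by (subst ennreal_mult) (auto intro!: sum_nonneg joint_nonneg mult_nonneg_nonneg)
    also have "\<dots> \<le> ennreal ((\<Sum>ys\<in>perms. \<Sum>G\<in>Pow {..<n}. joint G ys (fst s) * 1)
        + (?I s E1 + (?I s E2 + (?I s E3 + (?I s E4 + (?I s E5 + (?I s (E ?P) + ?I s (E ?P'))))))))"
      by (rule ennreal_leI[OF pointwise])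
    also have "\<dots> = ennreal (\<Sum>ys\<in>perms. \<Sum>G\<in>Pow {..<n}. joint G ys (fst s) * 1) + (ennreal (?I s E1)
      + (ennreal (?I s E2) + (ennreal (?I s E3) + (ennreal (?I s E4) + (ennreal (?I s E5) + (ennreal (?I s (E ?P)) + ennreal (?I s (E ?P'))))))))"
      using I0[of s] sum_nonneg[of perms "\<lambda>ys. \<Sum>G\<in>Pow {..<n}. joint G ys (fst s) * 1"]
        sum_nonneg[of "Pow {..<n}" "\<lambda>G. joint G _ (fst s) * 1"] joint_nonneg
      by (simp add: ennreal_plus del: mult_1_right)
    finally show "2 * ennreal (\<Sum>ys\<in>perms. \<Sum>G\<in>Pow {..<n}. joint G ys (fst s) * of_bool (snd s = Some (threshold_set v ys))) \<le> \<dots>" .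
  qed
  also have "\<dots> = ?path (\<lambda>s. ennreal (\<Sum>ys\<in>perms. \<Sum>G\<in>Pow {..<n}. joint G ys (fst s) * 1)) + (?path (\<lambda>s. ennreal (?I s E1))
      + (?path (\<lambda>s. ennreal (?I s E2)) + (?path (\<lambda>s. ennreal (?I s E3)) + (?path (\<lambda>s. ennreal (?I s E4))
      + (?path (\<lambda>s. ennreal (?I s E5)) + (?path (\<lambda>s. ennreal (?I s (E ?P))) + ?path (\<lambda>s. ennreal (?I s (E ?P')))))))))"
    by (simp only: path_sum_add)
  also have "\<dots> \<le> ennreal K + (ennreal (K * (1 - dprob) ^ k) + (ennreal (K * (1 - dprob) ^ (n - k)) + (ennreal (K * \<kappa>1)
     + (ennreal (K * \<kappa>2) + (ennreal (K * (r * T)) + (ennreal (K * ?x) + ennreal (K * ?x)))))))"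
    by (intro add_mono b0 b1 b2 b3 b4 b5 b6)
  also have "\<dots> = ennreal (K + (K * (1 - dprob) ^ k + (K * (1 - dprob) ^ (n - k) + (K * \<kappa>1
     + (K * \<kappa>2 + (K * (r * T) + (K * ?x + K * ?x)))))))"
  proof -
    have plus: "ennreal a1 + (ennreal a2 + (ennreal a3 + (ennreal a4 + (ennreal a5 + (ennreal a6 + (ennreal a7 + ennreal a8))))))
        = ennreal (a1 + (a2 + (a3 + (a4 + (a5 + (a6 + (a7 + a8)))))))"
      if "0 \<le> a1" "0 \<le> a2" "0 \<le> a3" "0 \<le> a4" "0 \<le> a5" "0 \<le> a6" "0 \<le> a7" "0 \<le> a8"
      for a1 a2 a3 a4 a5 a6 a7 a8
      using that by simp
    show ?thesis
      using K nn \<kappa>2 T dprob m0 by (intro plus mult_nonneg_nonneg) (auto simp: r_def)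
  qed
  finally have "2 * (K * (33/50)) \<le> K + (K * (1 - dprob) ^ k + (K * (1 - dprob) ^ (n - k) + (K * \<kappa>1
     + (K * \<kappa>2 + (K * (r * T) + (K * ?x + K * ?x))))))"
  proof -
    have x0: "0 \<le> (1 - dprob) ^ j" for j using dprob by simp
    have "0 \<le> r" "0 \<le> ?x" using m0 by (auto simp: r_def)
    then have "0 \<le> K + (K * (1 - dprob) ^ k + (K * (1 - dprob) ^ (n - k) + (K * \<kappa>1
     + (K * \<kappa>2 + (K * (r * T) + (K * ?x + K * ?x))))))"
      using K nn \<kappa>2 T x0 by (intro add_nonneg_nonneg mult_nonneg_nonneg) auto
    moreover assume "ennreal (2 * (K * (33/50))) \<le> ennreal (K + (K * (1 - dprob) ^ k + (K * (1 - dprob) ^ (n - k) + (K * \<kappa>1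
     + (K * \<kappa>2 + (K * (r * T) + (K * ?x + K * ?x)))))))"
    ultimately show ?thesis by (simp add: ennreal_le_iff)
  qed
  then have "K * (66/50) \<le> K * (1 + ((1 - dprob) ^ k + (1 - dprob) ^ (n - k) + \<kappa>1 + \<kappa>2 + r * T + 2 * ?x))"
    by (simp add: algebra_simps)
  then have "66/50 \<le> 1 + ((1 - dprob) ^ k + (1 - dprob) ^ (n - k) + \<kappa>1 + \<kappa>2 + r * T + 2 * ?x)"
    using K by (simp only: mult_le_cancel_left_pos)
  then show ?thesis by (simp add: r_def)
qed

end

section \<open>Counting permutations: the price of conditioning on the multiset\<close>

text \<open>The lower half of Stirling's formula up to polynomial factors; the induction step uses
  \<open>(1 + 1/n) ^ n \<le> exp 1\<close>.\<close>

lemma power_self_le_fact_exp: "real n ^ n \<le> fact n * exp (real n)"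
proof (induction n)
  case (Suc n)
  have "real (Suc n) ^ n \<le> exp 1 * real n ^ n"
  proof (cases "n = 0")
    case False
    have "real (Suc n) ^ n = (1 + 1 / real n) ^ n * real n ^ n"
      using False by (simp add: field_simps flip: power_mult_distrib)
    also have "\<dots> \<le> exp (1 / real n) ^ n * real n ^ n"
      by (intro mult_right_mono power_mono exp_ge_add_one_self) auto
    also have "exp (1 / real n) ^ n = exp 1"
      using False by (simp flip: exp_of_nat_mult)
    finally show ?thesis .
  qed simp
  also have "\<dots> \<le> exp 1 * (fact n * exp (real n))"
    by (intro mult_left_mono Suc) auto
  finally have "real (Suc n) * real (Suc n) ^ n \<le> real (Suc n) * (exp 1 * (fact n * exp (real n)))"
    by (intro mult_left_mono) auto
  then show ?case by (simp add: exp_add algebra_simps)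
qed simp

text \<open>The upper half, with a loss of \<open>exp 1 * m\<close>; it rests on
  \<open>(m / (m + 1)) ^ (m + 1) \<le> exp (-1)\<close>.\<close>

lemma fact_exp_le:
  assumes "1 \<le> m" shows "fact m * exp (real m) \<le> exp 1 * real m * real m ^ m"
  using assms
proof (induction m rule: dec_induct)
  case (step m)
  have "real m / real (Suc m) = 1 + (- 1 / real (Suc m))" by (simp add: field_simps)
  also have "\<dots> \<le> exp (- 1 / real (Suc m))" by (rule exp_ge_add_one_self)
  finally have "(real m / real (Suc m)) ^ Suc m \<le> exp (- 1 / real (Suc m)) ^ Suc m"
    by (intro power_mono) auto
  also have "\<dots> = exp (-1)"
    by (simp add: exp_of_nat_mult[symmetric] del: power_Suc of_nat_Suc)
  finally have "exp 1 * real m ^ Suc m \<le> real (Suc m) ^ Suc m"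
    by (simp add: power_divide exp_minus field_simps del: power_Suc)
  then have "(real (Suc m) * exp 1) * (exp 1 * real m ^ Suc m) \<le> (real (Suc m) * exp 1) * real (Suc m) ^ Suc m"
    by (intro mult_left_mono) auto
  moreover have "(real (Suc m) * exp 1) * (fact m * exp (real m)) \<le> (real (Suc m) * exp 1) * (exp 1 * real m ^ Suc m)"
    using step.IH by (intro mult_left_mono) (auto simp: mult_ac)
  ultimately show ?case by (simp add: exp_add algebra_simps)
qed simp

text \<open>
  Independent draws from the empirical distribution of \<open>xs\<close> have the type of \<open>xs\<close> with
  probability at least \<open>(e n)\<close> to the power \<open>- card (set xs)\<close>.
\<close>

lemma card_permutations_times_type_prob:
  fixes xs :: "real list"
  assumes ne: "xs \<noteq> []"
  defines "n \<equiv> length xs" and "\<mu> \<equiv> \<lambda>x. real (count (mset xs) x) / real (length xs)"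
  shows "1 \<le> real (card (permutations_of_multiset (mset xs))) * (\<Prod>x\<in>set xs. \<mu> x ^ count (mset xs) x)
      * (exp 1 * real n) ^ card (set xs)"
proof -
  let ?c = "count (mset xs)" and ?K = "real (card (permutations_of_multiset (mset xs)))"
  have n: "0 < n" using ne by (simp add: n_def)
  have csum: "(\<Sum>x\<in>set xs. ?c x) = n"
    using size_multiset_overloaded_eq[of "mset xs"] by (simp add: n_def)
  \<comment> \<open>Stirling for each multiplicity \<open>c\<close>; the loss
    \<open>exp 1 * c\<close> is enlarged to \<open>exp 1 * n\<close> so that it becomes a power with
    exponent \<open>card (set xs)\<close>.\<close>
  have "(\<Prod>x\<in>set xs. fact (?c x) * exp (real (?c x))) \<le> (\<Prod>x\<in>set xs. (exp 1 * real n) * real (?c x) ^ ?c x)"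
  proof (intro prod_mono conjI)
    fix x assume x: "x \<in> set xs"
    then have "1 \<le> ?c x" by (simp add: Suc_le_eq)
    then have "fact (?c x) * exp (real (?c x)) \<le> exp 1 * real (?c x) * real (?c x) ^ ?c x"
      by (rule fact_exp_le)
    also have "\<dots> \<le> exp 1 * real n * real (?c x) ^ ?c x"
      using count_le_size[of "mset xs" x] by (intro mult_right_mono mult_left_mono) (auto simp: n_def)
    finally show "fact (?c x) * exp (real (?c x)) \<le> exp 1 * real n * real (?c x) ^ ?c x" .
  qed auto
  moreover have "(\<Prod>x\<in>set xs. exp (real (?c x))) = exp (real n)"
    by (simp add: exp_sum[symmetric] csum[symmetric])
  ultimately have 1: "(\<Prod>x\<in>set xs. fact (?c x)) * exp (real n)
      \<le> (exp 1 * real n) ^ card (set xs) * (\<Prod>x\<in>set xs. real (?c x) ^ ?c x)"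
    by (simp add: prod.distrib)
  \<comment> \<open>The number of permutations is the multinomial coefficient.\<close>
  have "?K * (\<Prod>x\<in>set xs. fact (?c x)) = fact n"
    using arg_cong[OF card_permutations_of_multiset_aux[of "mset xs"], of real]
    by (simp add: n_def)
  then have "real n ^ n \<le> ?K * ((\<Prod>x\<in>set xs. fact (?c x)) * exp (real n))"
    using power_self_le_fact_exp[of n] by (simp add: mult_ac)
  also have "\<dots> \<le> ?K * ((exp 1 * real n) ^ card (set xs) * (\<Prod>x\<in>set xs. real (?c x) ^ ?c x))"
    by (intro mult_left_mono 1) auto
  finally have "1 \<le> ?K * ((exp 1 * real n) ^ card (set xs) * (\<Prod>x\<in>set xs. real (?c x) ^ ?c x)) / real n ^ n"
    using n by (simp add: le_divide_eq)
  moreover have "(\<Prod>x\<in>set xs. \<mu> x ^ ?c x) = (\<Prod>x\<in>set xs. real (?c x) ^ ?c x) / real n ^ n"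
    by (simp add: \<mu>_def n_def[symmetric] power_divide prod_dividef power_sum[symmetric] csum)
  ultimately show ?thesis by (simp add: mult_ac)
qed

section \<open>From limits over time to one finite time\<close>

lemma prob_output_run_mono:
  assumes "t \<le> t'"
  shows "measure_pmf.prob (run A adv ys t) {(h, out). out = Some S}
    \<le> measure_pmf.prob (run A adv ys t') {(h, out). out = Some S}"
  using assms
proof (induction t' rule: dec_induct)
  case (step t')
  let ?E = "{(h :: history, out). out = Some S}"
  have "emeasure (measure_pmf (run A adv ys t')) ?E = (\<integral>\<^sup>+ s. indicator ?E s \<partial>measure_pmf (run A adv ys t'))"
    by simp
  also have "\<dots> \<le> emeasure (measure_pmf (run A adv ys (Suc t'))) ?E"
    by (auto simp: emeasure_bind_pmf indicator_def intro!: nn_integral_mono split: option.split)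
  finally show ?case using step.IH by (simp add: measure_pmf.emeasure_eq_measure del: run.simps)
qed simp

text \<open>The supremum 2/3 may not be attained at a finite time, hence the slightly smaller 33/50.
  Stopped runs keep their output, so the bound persists once reached.\<close>

lemma solves_threshold_eventually:
  assumes "solves_threshold A v ys"
  shows "\<forall>\<^sub>F t in sequentially. 33/50 \<le> measure_pmf.prob (run A adv ys t) {(h, out). out = Some (threshold_set v ys)}"
proof -
  let ?p = "\<lambda>t. measure_pmf.prob (run A adv ys t) {(h, out). out = Some (threshold_set v ys)}"
  have "2/3 \<le> (SUP t. ?p t)"
    using assms unfolding solves_threshold_def success_prob_def by blast
  then have "33/50 < (SUP t. ?p t)" by linarith
  moreover have bdd: "bdd_above (range ?p)"
    by (intro bdd_aboveI[of _ 1]) auto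
  ultimately obtain t0 where "33/50 < ?p t0"
    unfolding less_cSUP_iff[OF UNIV_not_empty bdd] by blast
  then have "33/50 \<le> ?p t" if "t0 \<le> t" for t
    using prob_output_run_mono[OF that, of A adv ys "threshold_set v ys"] by linarith
  then show ?thesis unfolding eventually_sequentially by blast
qed

lemma nn_integral_length_le_query_complexity:
  "(\<integral>\<^sup>+ s. of_nat (length (fst s)) \<partial>measure_pmf (run A adv ys t)) \<le> query_complexity A ys"
  unfolding query_complexity_def expected_queries_def by (intro SUP_upper2[of adv] SUP_upper) auto

context noise_instance
begin

lemma type_prob_eq: "type_prob = (\<Prod>x\<in>set xs. \<mu> x ^ count (mset xs) x)"
proof -
  have "type_prob = prod_mset (image_mset \<mu> (mset xs))"
    unfolding type_prob_def unfolding length_xs[symmetric]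
    by (simp add: prod_mset_prod_list prod.list_conv_set_nth atLeast0LessThan flip: mset_map)
  then show ?thesis by (simp add: image_prod_mset_multiplicity)
qed

text \<open>There are finitely many permutations and fake assignments, so one time serves all of
  them.\<close>

lemma common_time:
  assumes "correct_given_multiset A v (mset xs)"
  obtains t where "\<And>ys c. ys \<in> perms \<Longrightarrow> c \<in> fakes \<Longrightarrow>
      33/50 \<le> measure_pmf.prob (run A (fake_adv ys c) ys t) {(h, out). out = Some (threshold_set v ys)}"
proof -
  have "\<forall>\<^sub>F t in sequentially. \<forall>ys\<in>perms. \<forall>c\<in>fakes.
      33/50 \<le> measure_pmf.prob (run A (fake_adv ys c) ys t) {(h, out). out = Some (threshold_set v ys)}"
    using assms
    by (intro eventually_ball_finite finite_perms finite_fakes ballI solves_threshold_eventually)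
       (auto simp: correct_given_multiset_def perms_def)
  from eventually_happens'[OF sequentially_bot this] show ?thesis using that by blast
qed

end

section \<open>The linear, the logarithmic and the boundary lower bound\<close>

lemma empirical_noise_instance:
  fixes xs :: "real list"
  assumes "xs \<noteq> []" "0 \<le> \<kappa>" "\<kappa> \<le> 1"
  shows "noise_instance (length xs) (set xs) (\<lambda>x. real (count (mset xs) x) / real (length xs)) \<kappa> xs"
proof
  have "(\<Sum>x\<in>set xs. count (mset xs) x) = length xs"
    by (simp add: size_multiset_overloaded_eq flip: size_mset)
  then have "(\<Sum>x\<in>set xs. real (count (mset xs) x)) = real (length xs)"
    by (metis of_nat_sum)
  then show "(\<Sum>x\<in>set xs. real (count (mset xs) x) / real (length xs)) = 1"
    using assms by (simp flip: sum_divide_distrib)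
qed (use assms in auto)

text \<open>With \<open>\<kappa> = 1\<close> and \<open>q = 0\<close> every location is a deceiver,
  and its first query makes it late. Locations never queried can then be swapped, which gives the
  linear term.\<close>

lemma linear_lower_bound:
  fixes xs :: "real list" and T v :: real
  defines "n \<equiv> length xs" and "k \<equiv> num_ge v xs"
  assumes A: "algorithm_on n A" and k: "0 < k" "k < n"
    and correct: "correct_given_multiset A v (mset xs)"
    and cost: "\<And>ys. mset ys = mset xs \<Longrightarrow> query_complexity A ys \<le> ennreal T" and T: "0 \<le> T"
  shows "real n / 1250 \<le> T"
proof (rule ccontr)
  assume neg: "\<not> ?thesis"
  have xs: "xs \<noteq> []" using k by (auto simp: n_def)
  interpret noise_instance n "set xs" "\<lambda>x. real (count (mset xs) x) / real n" 1 0 xs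
    unfolding n_def by (rule empirical_noise_instance) (use xs in auto)
  obtain t where t: "\<And>ys c. ys \<in> perms \<Longrightarrow> c \<in> fakes \<Longrightarrow>
      33/50 \<le> measure_pmf.prob (run A (fake_adv ys c) ys t) {(h, out). out = Some (threshold_set v ys)}"
    using common_time[OF correct] by blast
  define B where "B = n div 50"
  \<comment> \<open>\<open>error_bound\<close> will be used with \<open>g0 = n\<close> and
    \<open>m0 = B\<close>; having \<open>B\<close> at most \<open>n / 50\<close> keeps
    \<open>m0 / (g0 - m0)\<close> below 1/49.\<close>
  have dprob: "dprob = 1" by (simp add: dprob_def)
  have "set_weight G * of_bool (card G < n) = 0" if G: "G \<in> Pow {..<n}" for G
  proof (cases "G = {..<n}")
    case False
    then obtain i where "i < n" "i \<notin> G" using G by auto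
    then have "set_weight G = 0" unfolding set_weight_def dprob by (intro prod_zero) auto
    then show ?thesis by simp
  qed simp
  then have small: "(\<Sum>G\<in>Pow {..<n}. set_weight G * of_bool (card G < n)) \<le> 0"
    by (intro eq_refl sum.neutral ballI)
  have "card (G \<inter> late h) \<le> card (late h)" for G h
    by (intro card_mono) auto
  \<comment> \<open>With \<open>m0 = B\<close> this event is impossible, since late deceivers are
    late locations.\<close>
  then have "(B < card (G \<inter> late h) \<and> card (late h) \<le> B) = False" for G h
    by (meson le_trans not_le)
  then have zero: "(\<lambda>s. ennreal (\<Sum>ys\<in>perms. \<Sum>G\<in>Pow {..<n}. joint G ys (fst s) *
       of_bool (B < card (G \<inter> late (fst s)) \<and> card (late (fst s)) \<le> B))) = (\<lambda>s :: history \<times> nat set option. 0)"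
    by (simp only: of_bool_eq mult_zero_right sum.neutral_const ennreal_0)
  have many: "path_sum A (set xs) t (\<lambda>s. ennreal (\<Sum>ys\<in>perms. \<Sum>G\<in>Pow {..<n}. joint G ys (fst s) *
       of_bool (B < card (G \<inter> late (fst s)) \<and> card (late (fst s)) \<le> B))) \<le> ennreal (real (card perms) * 0)"
    unfolding zero using path_sum_cmult[of A "set xs" t 0 "\<lambda>_. 0"] by simp
  have Bn: "50 * B \<le> n" "n < 50 * (B + 1)" by (auto simp: B_def)
  have "8/25 \<le> (1 - dprob) ^ k + (1 - dprob) ^ (n - k) + 0 + 0
    + T / (real (0 + 1) * real (B + 1)) + 2 * (real B / (real n - real B))"
    unfolding k_def
  proof (rule error_bound[OF A _ T t _ small many])
    show "B < n" using Bn k by linarith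
    show "(\<integral>\<^sup>+ s. of_nat (length (fst s)) \<partial>measure_pmf (run A (fake_adv ys c) ys t)) \<le> ennreal T"
      if "ys \<in> perms" "c \<in> fakes" for ys c
      using that cost[of ys] order_trans[OF nn_integral_length_le_query_complexity] by (auto simp: perms_def)
  qed simp_all
  then have "8/25 \<le> T / real (B + 1) + 2 * (real B / (real n - real B))"
    using k by (simp add: dprob power_0_left)
  moreover have "T / real (B + 1) \<le> 1/25"
    using neg Bn by (simp add: divide_le_eq)
  moreover have "real B / (real n - real B) \<le> 1/49"
    using Bn k by (subst divide_le_eq) auto
  ultimately show False by linarith
qed

text \<open>With \<open>\<kappa> = 1/2\<close> a location is a deceiver with probability
  \<open>p / 2\<close>. Five error terms are at most 1/25 each and the last is at most 2/49, which
  together stays below 8/25. The condition \<open>types\<close> makes the price of conditioning on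
  the multiset smaller than the gain from tilting.\<close>

lemma logarithmic_lower_bound:
  fixes xs :: "real list" and T v :: real and q :: nat
  defines "n \<equiv> length xs" and "k \<equiv> num_ge v xs" and "p \<equiv> (1/3 :: real) ^ q"
  assumes A: "algorithm_on n A" and k: "8 \<le> p * real k" "8 \<le> p * real (n - k)"
    and np: "40 \<le> real n * p"
    and types: "real (card (set xs)) * (1 + ln (real n)) + ln 50 \<le> real n * p / 4000"
    and correct: "correct_given_multiset A v (mset xs)"
    and cost: "\<And>ys. mset ys = mset xs \<Longrightarrow> query_complexity A ys \<le> ennreal T" and T: "0 \<le> T"
  shows "real (q + 1) * real n / 100000 \<le> T"
proof (rule ccontr)
  assume neg: "\<not> ?thesis"
  have n: "0 < n" using np by (cases n) auto
  then have xs: "xs \<noteq> []" by (auto simp: n_def)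
  have p: "0 < p" "p \<le> 1" by (auto simp: p_def power_le_one)
  let ?\<mu> = "\<lambda>x. real (count (mset xs) x) / real n"
  interpret noise_instance n "set xs" ?\<mu> "1/2" q xs
    unfolding n_def by (rule empirical_noise_instance) (use xs in auto)
  obtain t where t: "\<And>ys c. ys \<in> perms \<Longrightarrow> c \<in> fakes \<Longrightarrow>
      33/50 \<le> measure_pmf.prob (run A (fake_adv ys c) ys t) {(h, out). out = Some (threshold_set v ys)}"
    using common_time[OF correct] by blast
  have dprob: "dprob = p / 2" by (simp add: dprob_def p_def)
  have \<rho>: "\<rho> = p" by (simp add: \<rho>_def dprob)
  \<comment> \<open>\<open>g0\<close> is about a quarter of the expected number
    \<open>n * p / 2\<close> of deceivers and \<open>m0\<close> a small fraction of
    \<open>g0\<close>. \<open>B\<close> is so small that \<open>(1 + p) ^ B\<close> and the price of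
    conditioning are each at most \<open>exp (n * p / 4000)\<close>, while \<open>2 ^ m0\<close> is
    about \<open>exp (n * p / 2000)\<close> or more.\<close>
  define g0 where "g0 = nat \<lfloor>real n * p / 8\<rfloor>"
  define m0 where "m0 = nat \<lfloor>real n * p / 1000\<rfloor>"
  define B where "B = nat \<lfloor>real n / 4000\<rfloor>"
  have g0: "real g0 \<le> real n * p / 8" "real n * p / 8 - 1 \<le> real g0"
    using p np by (auto simp: g0_def) linarith+
  have m0: "real m0 \<le> real n * p / 1000" "real n * p / 1000 - 1 \<le> real m0"
    using p np by (auto simp: m0_def) linarith+
  have B: "real B \<le> real n / 4000" "real n / 4000 \<le> real (B + 1)"
    by (auto simp: B_def) linarith+
  define l where "l = card (set xs)"
  define r where "r = (exp 1 * real n) ^ l"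
  have r: "0 < r" using n by (simp add: r_def)
  have KQ: "1 \<le> real (card perms) * type_prob * r"
    unfolding type_prob_eq using card_permutations_times_type_prob[OF xs]
    by (simp only: perms_eq r_def l_def n_def)
  have type_prob: "0 < type_prob"
  proof -
    have "0 \<le> type_prob" by (simp add: type_prob_def prod_nonneg)
    moreover have "type_prob \<noteq> 0" using KQ by auto
    ultimately show ?thesis by simp
  qed
  have exp_l: "r * 50 \<le> exp (real n * p / 4000)"
  proof -
    have "r = exp (real l * (1 + ln (real n)))"
      using n by (simp add: r_def exp_of_nat_mult exp_add power_mult_distrib)
    then have "r * 50 = exp (real l * (1 + ln (real n)) + ln 50)"
      by (simp add: exp_add)
    then show ?thesis using types by (simp add: l_def)
  qed
  have \<kappa>2: "(1 + \<rho>) ^ B / (2 ^ m0 * type_prob) \<le> real (card perms) * (1/25)"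
  proof -
    have "(1 + p) ^ B \<le> exp p ^ B"
      using p by (intro power_mono exp_ge_add_one_self) auto
    also have "\<dots> = exp (p * real B)" by (simp add: exp_of_nat2_mult)
    also have "\<dots> \<le> exp (real n * p / 4000)"
      using B p by (simp add: mult.commute pos_le_divide_eq)
    finally have 1: "(1 + p) ^ B \<le> exp (real n * p / 4000)" .
    \<comment> \<open>Uses \<open>ln 2 \<ge> 1/2\<close>; the \<open>+ 1\<close> below makes up for
      rounding \<open>m0\<close> down.\<close>
    have "exp (real n * p / 2000) \<le> exp (ln 2 * (real n * p / 1000))"
      using ln2_ge_two_thirds p mult_right_mono[of "1/2" "ln 2" "real n * p / 1000"] by simp
    also have "\<dots> \<le> exp (ln 2 * (real m0 + 1))"
      using m0 by (subst exp_le_cancel_iff, intro mult_left_mono) auto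
    also have "\<dots> = 2 * 2 ^ m0"
      by (simp add: distrib_left exp_add exp_of_nat2_mult)
    finally have 2: "exp (real n * p / 2000) \<le> 2 * 2 ^ m0" .
    have "(1 + p) ^ B * (r * 50) \<le> exp (real n * p / 4000) * exp (real n * p / 4000)"
      using r by (intro mult_mono 1 exp_l) auto
    also have "\<dots> = exp (real n * p / 2000)" by (simp flip: exp_add)
    finally have "(1 + p) ^ B * (r * 50) \<le> 2 * 2 ^ m0" using 2 by linarith
    then have "(1 + p) ^ B * r \<le> 2 ^ m0 * (1/25)" by (simp add: mult_ac)
    then have "(1 + p) ^ B * (r * (real (card perms) * type_prob)) \<le> 2 ^ m0 * (1/25) * (real (card perms) * type_prob)"
      using mult_right_mono[of "(1 + p) ^ B * r" "2 ^ m0 * (1/25)" "real (card perms) * type_prob"] type_prob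
      by (simp only: mult.assoc) simp
    moreover have "(1 + p) ^ B * 1 \<le> (1 + p) ^ B * (r * (real (card perms) * type_prob))"
      using KQ p by (intro mult_left_mono) (auto simp: mult_ac)
    ultimately have "(1 + p) ^ B \<le> real (card perms) * (1/25) * (2 ^ m0 * type_prob)"
      by (simp add: mult_ac)
    then show ?thesis using type_prob by (simp add: \<rho> divide_le_eq)
  qed
  have many: "path_sum A (set xs) t (\<lambda>s. ennreal (\<Sum>ys\<in>perms. \<Sum>G\<in>Pow {..<n}. joint G ys (fst s) *
       of_bool (m0 < card (G \<inter> late (fst s)) \<and> card (late (fst s)) \<le> B))) \<le> ennreal (real (card perms) * (1/25))"
    using path_sum_many_late[OF A _ type_prob, of t m0 B] \<kappa>2
    by (auto intro: order_trans[OF _ ennreal_leI])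
  have pow: "(1 - x) ^ j \<le> exp (- (x * real j))" if "x \<le> 1" for x :: real and j :: nat
  proof -
    have "(1 - x) ^ j \<le> exp (- x) ^ j"
      using that exp_ge_add_one_self[of "- x"] by (intro power_mono) auto
    then show ?thesis by (simp flip: exp_of_nat2_mult)
  qed
  have e4: "exp (-4) \<le> (1/25 :: real)"
  proof -
    have "(5/2 :: real) \<le> exp 1" using exp_lower_Taylor_quadratic[of 1] by simp
    then have "(5/2 :: real) ^ 4 \<le> exp 1 ^ 4" by (intro power_mono) auto
    then have "25 \<le> exp (4::real)" by (simp add: exp_of_nat_mult[symmetric] power_divide)
    then show ?thesis by (simp add: exp_minus field_simps)
  qed
  have small: "(\<Sum>G\<in>Pow {..<n}. set_weight G * of_bool (card G < g0)) \<le> 1/25"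
  proof -
    have "2 ^ g0 \<le> exp (real n * p / 8)"
    proof -
      have "(2::real) ^ g0 \<le> exp 1 ^ g0" using exp_ge_add_one_self[of 1] by (intro power_mono) auto
      also have "\<dots> = exp (real g0)" by (simp flip: exp_of_nat_mult)
      finally show ?thesis using g0 by (meson exp_le_cancel_iff order_trans)
    qed
    moreover have "(1 - dprob / 2) ^ n \<le> exp (- (real n * p / 4))"
      using pow[of "dprob / 2" n] p by (simp add: dprob mult.commute)
    ultimately have "2 ^ g0 * (1 - dprob / 2) ^ n \<le> exp (real n * p / 8) * exp (- (real n * p / 4))"
      using p by (intro mult_mono) (auto simp: dprob)
    also have "\<dots> = exp (- (real n * p / 8))" by (simp flip: exp_add)
    also have "\<dots> \<le> exp (-4)" using np by simp
    finally show ?thesis using e4 sum_set_weight_small[of g0] by linarith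
  qed
  have m0g0: "m0 < g0" using m0 g0 np by linarith
  have "8/25 \<le> (1 - dprob) ^ k + (1 - dprob) ^ (n - k) + 1/25 + 1/25
    + T / (real (q + 1) * real (B + 1)) + 2 * (real m0 / (real g0 - real m0))"
    unfolding k_def
  proof (rule error_bound[OF A m0g0 T t _ small many])
    show "(\<integral>\<^sup>+ s. of_nat (length (fst s)) \<partial>measure_pmf (run A (fake_adv ys c) ys t)) \<le> ennreal T"
      if "ys \<in> perms" "c \<in> fakes" for ys c
      using that cost[of ys] order_trans[OF nn_integral_length_le_query_complexity] by (auto simp: perms_def)
  qed simp_all
  moreover have "(1 - dprob) ^ j \<le> 1/25" if "8 \<le> p * real j" for j
  proof -
    have "(1 - dprob) ^ j \<le> exp (- (dprob * real j))" using p by (intro pow) (simp add: dprob)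
    also have "\<dots> \<le> exp (-4)" using that by (simp add: dprob)
    finally show ?thesis using e4 by linarith
  qed
  then have "(1 - dprob) ^ k \<le> 1/25" "(1 - dprob) ^ (n - k) \<le> 1/25" using k by auto
  moreover have "T / (real (q + 1) * real (B + 1)) \<le> 1/25"
  proof -
    \<comment> \<open>The constant 100000 is \<open>4000 * 25\<close>.\<close>
    have "T \<le> real (q + 1) * (real n / 4000) / 25" using neg by simp
    also have "\<dots> \<le> real (q + 1) * real (B + 1) / 25"
      by (intro divide_right_mono mult_left_mono B) auto
    finally show ?thesis by (subst divide_le_eq) auto
  qed
  moreover have "real m0 / (real g0 - real m0) \<le> 1/49"
    using m0 g0 np m0g0 by (subst divide_le_eq) auto
  ultimately show False by linarith
qed

text \<open>When all values or none reach \<open>v\<close>, every permutation has the same answer,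
  so the comparison is with inputs outside the multiset. Moving one element across the threshold
  changes the answer, and against a truthful adversary only a query to that element reveals the
  change.\<close>

lemma boundary_lower_bound:
  fixes xs :: "real list" and v :: real
  defines "n \<equiv> length xs"
  assumes A: "algorithm_on n A" and correct: "correct_on_all_inputs A v n"
  shows "ennreal (real n / 4) \<le> query_complexity A xs"
proof -
  define V where "V = set xs \<union> {v - 1, v}"
  define flip where "flip i = xs[i := if v \<le> xs ! i then v - 1 else v]" for i
  have V: "finite V" by (simp add: V_def)
  have flip_len: "length (flip i) = n" for i by (simp add: flip_def n_def)
  have flip_nth: "flip i ! j = xs ! j" if "j \<noteq> i" for i j using that by (simp add: flip_def)
  define M where "M ys t = run A (\<lambda>h i. return_pmf (ys ! i)) ys t" for ys t
  define ok where "ok ys = {(h :: history, out). out = Some (threshold_set v ys)}" for ys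
  have "\<forall>\<^sub>F t in sequentially. 33/50 \<le> measure_pmf.prob (M ys t) (ok ys)" if "length ys = n" for ys
    using correct that solves_threshold_eventually by (simp add: correct_on_all_inputs_def M_def ok_def)
  then have "\<forall>\<^sub>F t in sequentially. 33/50 \<le> measure_pmf.prob (M xs t) (ok xs) \<and>
      (\<forall>i\<in>{..<n}. 33/50 \<le> measure_pmf.prob (M (flip i) t) (ok (flip i)))"
    by (auto simp: eventually_conj_iff eventually_ball_finite_distrib flip_len n_def[symmetric])
  from eventually_happens'[OF sequentially_bot this]
  obtain t where t: "33/50 \<le> measure_pmf.prob (M xs t) (ok xs)"
      "\<And>i. i < n \<Longrightarrow> 33/50 \<le> measure_pmf.prob (M (flip i) t) (ok (flip i))"
    by blast
  have queried: "8/25 \<le> measure_pmf.prob (M xs t) {s. resp i (fst s) \<noteq> []}" if i: "i < n" for i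
  proof -
    \<comment> \<open>Runs that are correct for \<open>xs\<close> and never touch \<open>i\<close>:
      they are wrong for \<open>flip i\<close> and have the same probability under both
      inputs.\<close>
    let ?F = "{s. s \<in> ok xs \<and> resp i (fst s) = []}"
    have emb: "emeasure (measure_pmf (M ys t)) ?F =
        path_sum A V t (\<lambda>s. ennreal (\<Prod>j<n. lik (ys ! j) (ys ! j) (resp j (fst s))) * indicator ?F s)"
      if "\<And>j. j < n \<Longrightarrow> ys ! j \<in> V" for ys
      unfolding M_def using nn_integral_run[OF A V that that, where \<phi> = "indicator ?F" and t = t] by simp
    have "(\<lambda>s. ennreal (\<Prod>j<n. lik (flip i ! j) (flip i ! j) (resp j (fst s))) * indicator ?F s) =
        (\<lambda>s. ennreal (\<Prod>j<n. lik (xs ! j) (xs ! j) (resp j (fst s))) * indicator ?F s)"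
    proof
      fix s :: "history \<times> nat set option"
      show "ennreal (\<Prod>j<n. lik (flip i ! j) (flip i ! j) (resp j (fst s))) * indicator ?F s =
        ennreal (\<Prod>j<n. lik (xs ! j) (xs ! j) (resp j (fst s))) * indicator ?F s"
      proof (cases "s \<in> ?F")
        case True
        have "(\<Prod>j<n. lik (flip i ! j) (flip i ! j) (resp j (fst s))) = (\<Prod>j<n. lik (xs ! j) (xs ! j) (resp j (fst s)))"
        proof (intro prod.cong refl)
          fix j show "lik (flip i ! j) (flip i ! j) (resp j (fst s)) = lik (xs ! j) (xs ! j) (resp j (fst s))"
            using True flip_nth[of j i] by (cases "j = i") auto
        qed
        then show ?thesis by simp
      qed simp
    qed
    moreover have "flip i ! j \<in> V" if "j < n" for j
      using that by (cases "j = i") (auto simp: flip_def V_def n_def)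
    moreover have "xs ! j \<in> V" if "j < n" for j using that by (auto simp: V_def n_def)
    ultimately have "emeasure (measure_pmf (M (flip i) t)) ?F = emeasure (measure_pmf (M xs t)) ?F"
      using emb[of "flip i"] emb[of xs] by simp
    then have eq: "measure_pmf.prob (M (flip i) t) ?F = measure_pmf.prob (M xs t) ?F"
      by (simp add: measure_def)
    have "threshold_set v (flip i) \<noteq> threshold_set v xs"
    proof
      assume "threshold_set v (flip i) = threshold_set v xs"
      then have "i \<in> threshold_set v (flip i) \<longleftrightarrow> i \<in> threshold_set v xs" by simp
      then show False using i by (auto simp: threshold_set_def flip_def n_def split: if_splits)
    qed
    then have "?F \<inter> ok (flip i) = {}" by (auto simp: ok_def)
    then have "measure_pmf.prob (M (flip i) t) ?F + measure_pmf.prob (M (flip i) t) (ok (flip i)) \<le> 1"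
      by (subst measure_pmf.finite_measure_Union[symmetric]) auto
    then have "measure_pmf.prob (M xs t) ?F \<le> 17/50" using t(2)[OF i] eq by simp
    moreover have "measure_pmf.prob (M xs t) (ok xs) \<le> measure_pmf.prob (M xs t) (?F \<union> {s. resp i (fst s) \<noteq> []})"
      by (intro measure_pmf.finite_measure_mono) auto
    moreover have "\<dots> \<le> measure_pmf.prob (M xs t) ?F + measure_pmf.prob (M xs t) {s. resp i (fst s) \<noteq> []}"
      by (rule measure_Un_le) auto
    ultimately show ?thesis using t(1) by linarith
  qed
  have "ennreal (real n / 4) \<le> ennreal (\<Sum>i<n. 8/25)" by (intro ennreal_leI) simp
  also have "\<dots> \<le> ennreal (\<Sum>i<n. measure_pmf.prob (M xs t) {s. resp i (fst s) \<noteq> []})"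
    by (intro ennreal_leI sum_mono queried) auto
  also have "\<dots> = (\<Sum>i<n. \<integral>\<^sup>+ s. indicator {s. resp i (fst s) \<noteq> []} s \<partial>measure_pmf (M xs t))"
    by (simp add: measure_pmf.emeasure_eq_measure)
  also have "\<dots> = (\<integral>\<^sup>+ s. (\<Sum>i<n. indicator {s. resp i (fst s) \<noteq> []} s) \<partial>measure_pmf (M xs t))"
    by (rule nn_integral_sum[symmetric]) auto
  also have "\<dots> \<le> (\<integral>\<^sup>+ s. of_nat (length (fst s)) \<partial>measure_pmf (M xs t))"
  proof (intro nn_integral_mono)
    fix s :: "history \<times> nat set option"
    have "(\<Sum>i<n. indicator {s. resp i (fst s) \<noteq> []} s :: ennreal) \<le> (\<Sum>i<n. of_nat (length (resp i (fst s))))"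
    proof (intro sum_mono)
      fix i
      show "indicator {s. resp i (fst s) \<noteq> []} s \<le> (of_nat (length (resp i (fst s))) :: ennreal)"
        by (cases "resp i (fst s)") (auto simp: indicator_def)
    qed
    also have "\<dots> \<le> of_nat (length (fst s))"
      unfolding of_nat_sum[symmetric] by (intro of_nat_mono sum_length_resp_le) auto
    finally show "(\<Sum>i<n. indicator {s. resp i (fst s) \<noteq> []} s :: ennreal) \<le> of_nat (length (fst s))" .
  qed
  also have "\<dots> \<le> query_complexity A xs"
    unfolding M_def by (rule nn_integral_length_le_query_complexity)
  finally show ?thesis .
qed

section \<open>Choice of the parameters and conclusion\<close>

text \<open>Half of the saved exponent absorbs the logarithm. The power
  \<open>n powr (1 - e / 2)\<close> stands for the lower bound on \<open>n * (1/3) ^ q\<close> that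
  the later choice of \<open>q\<close> guarantees.\<close>

lemma eventually_types_negligible:
  fixes C e :: real
  assumes "0 < e" "e \<le> 1"
  shows "\<forall>\<^sub>F n :: nat in sequentially. C * real n powr (1 - e) * (1 + ln (real n)) + ln 50 \<le> real n powr (1 - e / 2) / 4000
    \<and> 40 \<le> real n powr (1 - e / 2)"
proof (rule eventually_conj)
  have "(\<lambda>n :: nat. C * (real n powr (1 - e) * (1 + ln (real n)) / real n powr (1 - e / 2))
      + ln 50 / real n powr (1 - e / 2)) \<longlonglongrightarrow> C * 0 + 0"
  proof (intro tendsto_add tendsto_mult tendsto_const)
    have "(\<lambda>n :: nat. (1 + ln (real n)) / real n powr (e / 2)) \<longlonglongrightarrow> 0"
      using assms by real_asymp
    moreover have "\<forall>\<^sub>F n :: nat in sequentially. (1 + ln (real n)) / real n powr (e / 2) =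
        real n powr (1 - e) * (1 + ln (real n)) / real n powr (1 - e / 2)"
      using eventually_gt_at_top[of 0]
    proof eventually_elim
      case (elim n)
      have "real n powr (1 - e / 2) = real n powr (1 - e) * real n powr (e / 2)"
        by (simp flip: powr_add)
      then show ?case using elim by simp
    qed
    ultimately show "(\<lambda>n :: nat. real n powr (1 - e) * (1 + ln (real n)) / real n powr (1 - e / 2)) \<longlonglongrightarrow> 0"
      by (rule Lim_transform_eventually)
    show "(\<lambda>n :: nat. ln 50 / real n powr (1 - e / 2)) \<longlonglongrightarrow> 0"
      using assms by real_asymp
  qed
  then have "(\<lambda>n :: nat. (C * real n powr (1 - e) * (1 + ln (real n)) + ln 50) / real n powr (1 - e / 2)) \<longlonglongrightarrow> 0"
    by (simp add: add_divide_distrib mult.assoc)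
  then have "\<forall>\<^sub>F n :: nat in sequentially.
      (C * real n powr (1 - e) * (1 + ln (real n)) + ln 50) / real n powr (1 - e / 2) < 1 / 4000"
    by (rule order_tendstoD) simp
  then show "\<forall>\<^sub>F n :: nat in sequentially.
      C * real n powr (1 - e) * (1 + ln (real n)) + ln 50 \<le> real n powr (1 - e / 2) / 4000"
    using eventually_gt_at_top[of 0] by eventually_elim (simp add: divide_less_eq)
  have "filterlim (\<lambda>n :: nat. real n powr (1 - e / 2)) at_top sequentially"
    using assms by real_asymp
  then show "\<forall>\<^sub>F n :: nat in sequentially. 40 \<le> real n powr (1 - e / 2)"
    by (simp add: filterlim_at_top)
qed

text \<open>\<open>q\<close> is \<open>d * log 3 m\<close> rounded down; \<open>ln 3 \<le> 2\<close>
  accounts for the change of base.\<close>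

lemma query_exponent:
  fixes d :: real and m :: nat
  assumes d: "0 < d" and m: "1 \<le> m"
  obtains q :: nat where "real m powr (- d) \<le> (1/3) ^ q" "d * ln (real m) / 2 \<le> real (q + 1)"
proof
  define x where "x = d * log 3 (real m)"
  define q where "q = nat \<lfloor>x\<rfloor>"
  have x: "0 \<le> x" using d m by (simp add: x_def)
  have q: "real q \<le> x" "x \<le> real (q + 1)" using x by (auto simp: q_def) linarith
  have "real m powr (- d) = 3 powr (- x)"
    using m by (simp add: x_def powr_def log_def)
  also have "\<dots> \<le> 3 powr (- real q)" using q by (intro powr_mono) auto
  also have "\<dots> = (1/3) ^ q" by (simp add: powr_minus powr_realpow power_one_over inverse_eq_divide)
  finally show "real m powr (- d) \<le> (1/3) ^ q" .
  have "ln 3 \<le> (2 :: real)" using ln_le_minus_one[of 3] by simp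
  then have "d * ln (real m) / 2 \<le> d * ln (real m) / ln 3"
    using d m by (intro divide_left_mono) auto
  moreover have "d * ln (real m) / ln 3 = x" by (simp add: x_def log_def)
  ultimately show "d * ln (real m) / 2 \<le> real (q + 1)"
    using q(2) by linarith
qed

theorem mainTheorem6:
  fixes \<epsilon> C :: real
  assumes "\<epsilon> > 0"
  shows "\<exists>c>0. \<forall>(n::nat) (xs::real list) (v::real) (k::nat) (A::algorithm).
           length xs = n \<longrightarrow>
           real (card (set xs)) \<le> C * real n powr (1 - \<epsilon>) \<longrightarrow>
           k = num_ge v xs \<longrightarrow>
           algorithm_on n A \<longrightarrow>
           correct_on_all_inputs A v n \<or>
             (0 < k \<and> k < n \<and> correct_given_multiset A v (mset xs)) \<longrightarrow>
           (\<exists>ys. mset ys = mset xs \<and>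
              ennreal (c * (real n + real n * ln (real (min k (n - k)))))
                \<le> query_complexity A ys)"
proof -
  \<comment> \<open>Lowering \<open>\<epsilon>\<close> to at most 1 only weakens the bound on the
    number of distinct values and keeps \<open>1 - e\<close> nonnegative.\<close>
  define e where "e = min \<epsilon> 1"
  define d where "d = e / 2"
  have e: "0 < e" "e \<le> 1" "e \<le> \<epsilon>" and d: "0 < d" "d \<le> 1/2"
    using assms by (auto simp: e_def d_def)
  obtain n0 where n0: "\<And>n. n0 \<le> n \<Longrightarrow>
      \<bar>C\<bar> * real n powr (1 - e) * (1 + ln (real n)) + ln 50 \<le> real n powr (1 - d) / 4000 \<and> 40 \<le> real n powr (1 - d)"
    using eventually_types_negligible[OF e(1,2), of "\<bar>C\<bar>"] unfolding eventually_sequentially d_def by blast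
  \<comment> \<open>\<open>n0\<close> is where the asymptotic estimate starts; 64 enters through
    \<open>64 powr (1/2) = 8\<close>.\<close>
  define M where "M = max n0 64"
  define L where "L = 1 + ln (real M)"
  \<comment> \<open>The first entry serves the logarithmic bound and the second the linear one, each
    with a factor 2 to spare for the contradiction.\<close>
  define c where "c = min (d / 1000000) (1 / (2500 * L))"
  have M: "64 \<le> M" "n0 \<le> M" by (auto simp: M_def)
  then have L: "1 \<le> L" by (simp add: L_def)
  have c: "0 < c" "c \<le> d / 1000000" "c \<le> 1 / (2500 * L)"
    using d L by (auto simp: c_def)
  have c4: "c \<le> 1/4" using c d by simp
  have main: "\<exists>ys. mset ys = mset xs \<and>
      ennreal (c * (real n + real n * ln (real (min k (n - k))))) \<le> query_complexity A ys"
    if n: "length xs = n" and types: "real (card (set xs)) \<le> C * real n powr (1 - \<epsilon>)"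
      and k: "k = num_ge v xs" and A: "algorithm_on n A"
      and correct: "correct_on_all_inputs A v n \<or> (0 < k \<and> k < n \<and> correct_given_multiset A v (mset xs))"
    for n xs v k A
  proof (cases "0 < k \<and> k < n")
    case False
    have "threshold_set v xs \<subseteq> {..<n}" using n by (auto simp: threshold_set_def)
    then have "k \<le> n" using k card_mono[of "{..<n}" "threshold_set v xs"] by (simp add: num_ge_def)
    \<comment> \<open>Since \<open>ln 0 = 0\<close>, only the linear term is claimed here.\<close>
    then have "min k (n - k) = 0" using False by auto
    moreover have "c * real n \<le> real n / 4" using mult_right_mono[OF c4, of "real n"] by simp
    ultimately have "ennreal (c * (real n + real n * ln (real (min k (n - k))))) \<le> ennreal (real n / 4)"
      by (intro ennreal_leI) simp
    also have "\<dots> \<le> query_complexity A xs"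
      using boundary_lower_bound[of xs A v] A correct False n by auto
    finally show ?thesis by blast
  next
    case True
    define m where "m = min k (n - k)"
    define X where "X = c * (real n + real n * ln (real m))"
    have m: "1 \<le> m" "m \<le> n" "m \<le> k" "m \<le> n - k" using True by (auto simp: m_def)
    then have lnm: "0 \<le> ln (real m)" by simp
    have X: "0 \<le> X" using c lnm by (simp add: X_def)
    have corr: "correct_given_multiset A v (mset xs)"
      using correct n by (auto simp: correct_on_all_inputs_def correct_given_multiset_def dest: mset_eq_length)
    show ?thesis
    proof (rule ccontr)
      assume "\<not> ?thesis"
      then have cost: "query_complexity A ys \<le> ennreal X" if "mset ys = mset xs" for ys
        using that by (auto simp: X_def m_def not_le intro: less_imp_le)
      show False
      \<comment> \<open>Below \<open>M\<close> the logarithm is bounded and the linear bound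
        suffices; from \<open>M\<close> on the logarithmic bound applies.\<close>
      proof (cases "M \<le> m")
        case False
        have "real n / 1250 \<le> X"
          using linear_lower_bound[of xs A v X] A True corr cost X n k by simp
        moreover have "X \<le> real n / 2500"
        proof -
          have "X = c * (1 + ln (real m)) * real n" by (simp add: X_def algebra_simps)
          also have "\<dots> \<le> 1 / (2500 * L) * L * real n"
            using c lnm L False m by (intro mult_right_mono mult_mono) (auto simp: L_def)
          also have "\<dots> = real n / 2500" using L by simp
          finally show ?thesis .
        qed
        ultimately show False using True by simp
      next
        case large: True
        obtain q where q: "real m powr (- d) \<le> (1/3) ^ q" "d * ln (real m) / 2 \<le> real (q + 1)"
          using query_exponent[OF d(1) m(1)] by blast
        have nM: "n0 \<le> n" using M large m by linarith
        \<comment> \<open>Because \<open>d \<le> 1/2\<close>, the product is still at least the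
          square root of \<open>m\<close>.\<close>
        have m8: "8 \<le> (1/3) ^ q * real j" if "m \<le> j" for j
        proof -
          have "8 = (64 :: real) powr (1/2)" by (simp add: powr_half_sqrt real_sqrt_eq_iff)
          also have "\<dots> \<le> real m powr (1/2)" using M large by (intro powr_mono2) auto
          also have "\<dots> \<le> real m powr (1 - d)" using m d by (intro powr_mono) auto
          also have "\<dots> = real m powr (- d) * real m"
            using m powr_add[of "real m" "- d" 1] by simp
          also have "\<dots> \<le> (1/3) ^ q * real j" using q(1) that by (intro mult_mono) auto
          finally show ?thesis .
        qed
        have np: "real n powr (1 - d) \<le> real n * (1/3) ^ q"
        proof -
          have "real n powr (1 - d) = real n * real n powr (- d)"
            using m powr_add[of "real n" "- d" 1] by (simp add: mult.commute)
          also have "\<dots> \<le> real n * real m powr (- d)"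
            using m d by (intro mult_left_mono powr_mono2') auto
          also have "\<dots> \<le> real n * (1/3) ^ q" using q(1) by (intro mult_left_mono) auto
          finally show ?thesis .
        qed
        have "real (card (set xs)) \<le> \<bar>C\<bar> * real n powr (1 - e)"
        proof -
          have "C * real n powr (1 - \<epsilon>) \<le> \<bar>C\<bar> * real n powr (1 - e)"
            using m e by (intro mult_mono powr_mono) auto
          then show ?thesis using types by linarith
        qed
        then have "real (card (set xs)) * (1 + ln (real n)) \<le> \<bar>C\<bar> * real n powr (1 - e) * (1 + ln (real n))"
          using m by (intro mult_right_mono) auto
        then have types': "real (card (set xs)) * (1 + ln (real n)) + ln 50 \<le> real n * (1/3) ^ q / 4000"
          using n0[OF nM] np by linarith
        have "40 \<le> real n * (1/3) ^ q" using n0[OF nM] np by linarith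
        then have "real (q + 1) * real n / 100000 \<le> X"
          using logarithmic_lower_bound[of xs A q v X] A m8[of k] m8[of "n - k"] m types' corr cost X n k by simp
        moreover have "X \<le> real (q + 1) * real n / 200000"
        proof -
          \<comment> \<open>\<open>d * ln m / 4\<close> is at most half of \<open>q + 1\<close>, and
            the other half covers \<open>d / 4\<close>.\<close>
          have "d * (1 + ln (real m)) / 4 \<le> real (q + 1)" using q(2) d by (simp add: algebra_simps)
          then have "d / 1000000 * (1 + ln (real m)) \<le> real (q + 1) / 200000" by simp
          moreover have "c * (1 + ln (real m)) \<le> d / 1000000 * (1 + ln (real m))"
            using c lnm by (intro mult_right_mono) auto
          ultimately have "c * (1 + ln (real m)) * real n \<le> real (q + 1) / 200000 * real n"
            by (intro mult_right_mono) auto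
          then show ?thesis by (simp add: X_def algebra_simps)
        qed
        moreover have "0 < real (q + 1) * real n" using True by simp
        ultimately show False by linarith
      qed
    qed
  qed
  then show ?thesis using c(1) by blast
qed

end
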